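(* Let $b\in\mathbb{Z}$ and $f_{b,b}(x)=x^4+bx+b$, with $\theta$ a root. Suppose $b$ and $256-27b$ are square-free (so the coefficients satisfy the hypotheses of the monogeneity theorem for $x^4+ax+b$: $\frac{256b^3-27a^4}{\gcd(256b^3,27a^4)}$ square-free, $f$ irreducible, and every prime $p\mid\gcd(256b^3,27a^4)$ satisfies one of: (1) $p\mid a$, $p\mid b$, $p^2\nmid b$; (2) $p=2$, $2\nmid b$, $(a,b)\equiv(0,1)$ or $(2,3)$ in $\mathbb{Z}/4\mathbb{Z}\times\mathbb{Z}/4\mathbb{Z}$; (3) $p=3$, $3\nmid a$, $(a,b)$ congruent mod 9 to one of $(1,3),(1,6),(2,0),(2,3),(4,0),(4,6),(5,0),(5,6),(7,0),(7,3),(8,3),(8,6)$). If $b\neq 3,5$, then $\mathbb{Q}(\theta)$ has Galois group $S_4$. Moreover, the natural density of $b\in\mathbb{Z}$ for which $f_{b,b}$ satisfies these monogeneity hypotheses, among all polynomials $x^4+bx+b$ with $b\in\mathbb{Z}$, is at least $\frac{51-4\pi^2}{4\pi^2}\approx 29.18\%$.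
   Context: Under these hypotheses, $\mathbb{Q}(\theta)$ is monogenic and $\theta$ generates the ring of integers. *)

theory Defs
  imports
    "HOL-Algebra.Generated_Fields"
    "HOL-Algebra.Sym_Groups"
    "HOL-Algebra.Bij"
    "HOL-Algebra.Algebraic_Closure_Type"
    "HOL-Computational_Algebra.Computational_Algebra"
    Complex_Main
begin

definition quartic :: "int \<Rightarrow> int \<Rightarrow> int poly" where
  "quartic a b = [:b, a, 0, 0, 1:]"

text \<open>
  The integer \<open>256 b\<^sup>3 - 27 a\<^sup>4\<close> is the discriminant of \<open>x\<^sup>4 + a x + b\<close>. The gcd divides it, so the
  \<open>div\<close> below is exact; in the degenerate case \<open>a = b = 0\<close> the quotient is \<open>0\<close>, which is not
  square-free.
\<close>

definition quartic_gcd :: "int \<Rightarrow> int \<Rightarrow> int" where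
  "quartic_gcd a b = gcd (256 * b ^ 3) (27 * a ^ 4)"

definition monogeneity_prime_condition :: "int \<Rightarrow> int \<Rightarrow> int \<Rightarrow> bool" where
  "monogeneity_prime_condition a b p \<longleftrightarrow>
     (p dvd a \<and> p dvd b \<and> \<not> p\<^sup>2 dvd b) \<or>
     (p = 2 \<and> \<not> 2 dvd b \<and> (a mod 4, b mod 4) \<in> {(0, 1), (2, 3)}) \<or>
     (p = 3 \<and> \<not> 3 dvd a \<and>
        (a mod 9, b mod 9) \<in>
          {(1, 3), (1, 6), (2, 0), (2, 3), (4, 0), (4, 6),
           (5, 0), (5, 6), (7, 0), (7, 3), (8, 3), (8, 6)})"

definition monogeneity_hypotheses :: "int \<Rightarrow> int \<Rightarrow> bool" where
  "monogeneity_hypotheses a b \<longleftrightarrow>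
     squarefree ((256 * b ^ 3 - 27 * a ^ 4) div quartic_gcd a b) \<and>
     Factorial_Ring.irreducible (map_poly rat_of_int (quartic a b)) \<and>
     (\<forall>p. Factorial_Ring.prime p \<and> p dvd quartic_gcd a b \<longrightarrow> monogeneity_prime_condition a b p)"

text \<open>Number fields are regarded as subfields of the complex numbers.\<close>

abbreviation complex_ring :: "complex ring" where
  "complex_ring \<equiv> ring_of_type_algebra"

text \<open>A generated subfield contains \<open>1\<close>, hence all rationals, so this is \<open>\<rat>(\<theta>)\<close>.\<close>

definition rat_adjoin :: "complex \<Rightarrow> complex set" where
  "rat_adjoin \<theta> = generate_field complex_ring {\<theta>}"

text \<open>
  As every polynomial splits over the complex numbers, a rational polynomial splits over \<open>L\<close>
  iff all its complex roots lie in \<open>L\<close>.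
\<close>

definition normal_over_rat :: "complex set \<Rightarrow> bool" where
  "normal_over_rat L \<longleftrightarrow>
     subfield L complex_ring \<and>
     (\<forall>x\<in>L. Polynomial.algebraic x) \<and>
     (\<forall>p :: rat poly. Factorial_Ring.irreducible p \<and> (\<exists>x\<in>L. poly (map_poly of_rat p) x = 0) \<longrightarrow>
        {x. poly (map_poly of_rat p) x = 0} \<subseteq> L)"

text \<open>
  For a number field \<open>K\<close> this is the smallest normal extension of the rationals containing \<open>K\<close>:
  the field of all algebraic numbers is normal, and normality is preserved by intersections.
\<close>

definition galois_closure :: "complex set \<Rightarrow> complex set" where
  "galois_closure K = \<Inter> {L. normal_over_rat L \<and> K \<subseteq> L}"

definition rat_automorphism_group :: "complex set \<Rightarrow> (complex \<Rightarrow> complex) monoid" where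
  "rat_automorphism_group L =
     BijGroup L \<lparr>carrier :=
       {\<sigma> \<in> Bij L.
          \<sigma> \<in> ring_hom (complex_ring \<lparr>carrier := L\<rparr>) (complex_ring \<lparr>carrier := L\<rparr>) \<and>
          (\<forall>q. \<sigma> (of_rat q) = of_rat q)}\<rparr>"

text \<open>
  A number field need not be normal; its Galois group is by convention that of its Galois closure
  over the rationals.
\<close>

definition number_field_galois_group :: "complex set \<Rightarrow> (complex \<Rightarrow> complex) monoid" where
  "number_field_galois_group K = rat_automorphism_group (galois_closure K)"

definition has_natural_density :: "int set \<Rightarrow> real \<Rightarrow> bool" where
  "has_natural_density A \<delta> \<longleftrightarrow>
     (\<lambda>N :: nat. real (card {b \<in> A. \<bar>b\<bar> \<le> int N}) / real (card {b :: int. \<bar>b\<bar> \<le> int N}))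
       \<longlonglongrightarrow> \<delta>"

end

theory Submission
  imports Defs "HOL-Analysis.Complex_Transcendental" "HOL-Real_Asymp.Real_Asymp"
begin

text \<open>
  Galois group. Fix an enumeration \<open>\<theta>\<close> of the roots whose power sums are rational, and let \<open>G\<close> be the set
  of permutations of the roots that preserve all rational polynomial relations between them. The
  indicator function of \<open>G\<close> is itself given by a rational polynomial in the permuted roots, so sums
  over \<open>G\<close> of polynomial expressions in the roots are rational; hence the values on \<open>G\<close> of such an
  expression are exactly the conjugates of its value at the identity, and their number divides the
  order of \<open>G\<close>. For \<open>x\<^sup>4 + b x + b\<close>, a root and a root of the resolvent cubic \<open>y\<^sup>3 - 4 b y - b\<^sup>2\<close>
  (irreducible unless \<open>b\<close> is \<open>3\<close> or \<open>5\<close>) show that \<open>12\<close> divides the order of \<open>G\<close>, and \<open>G\<close> is not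
  the alternating group because the discriminant \<open>b\<^sup>3 (256 - 27 b)\<close> is not a square.

  Density. The hypotheses say that no \<open>k\<^sup>2\<close> with \<open>k \<ge> 2\<close> divides \<open>b\<close> or \<open>256 - 27 b\<close>. Truncating to
  \<open>k \<le> z\<close> gives periodic sets, whose densities exist and differ from the wanted frequencies by at
  most \<open>2 / z + o(1)\<close>. The excluded \<open>b\<close> have density at most
  \<open>1/4 + 1/9 + 2 (1/5\<^sup>2 + 1/7\<^sup>2 + 1/9\<^sup>2 + \<dots>) \<le> 11/18\<close>.
\<close>

text \<open>On the Galois side, rationality of sums over G stands in for the fixed-field statement,
  so no field degrees or towers occur. The obstacle is that G is cut out by infinitely many
  relations; but only finitely many permutations lie outside it, and each is detected by one
  relation. Square-freeness of \<open>b\<close> enters through one mechanism: if \<open>b\<close>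
  divides a power of \<open>y\<close>, then \<open>y = b * k\<close>. After this substitution the
  monic equations collapse to unit equations, and the exceptions 3 and 5 come from the units
  \<open>k = -1\<close> and \<open>k = 1\<close>. A square discriminant would likewise force
  \<open>b = 256 - 27 * b\<close>. In the density bound the primes 2 and 3 count only once: 4
  divides \<open>256 - 27 * b\<close> only if it divides \<open>b\<close>, and 9 never divides it.
  From 5 on, both numbers contribute, whence the factor 2. Squares above \<open>256 + 27 * N\<close>
  cannot divide either number (\<open>b = 0\<close> aside) when \<bar>b\<bar> \<le> N, so the
  rounding errors, one per \<open>k\<close>, add up to O(sqrt N). The resulting 7/18 exceeds the
  claimed constant, about 0.2918.\<close>

section \<open>Rational power sums give rational coefficients\<close>

text \<open>Newton's identities, read off from \<open>P' = \<Sum>\<^sub>i P / (X - v\<^sub>i)\<close> by synthetic division.\<close>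

lemma coeffs_in_Rats_if_power_sums:
  fixes v :: "'i \<Rightarrow> complex"
  assumes fin: "finite I" and ps: "\<And>k. (\<Sum>i\<in>I. v i ^ k) \<in> \<rat>"
  shows "coeff (\<Prod>i\<in>I. [:- v i, 1:]) k \<in> \<rat>"
proof -
  define P where "P = (\<Prod>i\<in>I. [:- v i, 1:])"
  define q where "q i = synthetic_div P (v i)" for i
  define n where "n = card I"
  have deg: "degree P = n" unfolding P_def n_def
    by (simp add: degree_prod_eq_sum_degree)
  have lead: "coeff P n = 1"
    using lead_coeff_prod[of "\<lambda>i. [:- v i, 1:]" I] by (simp add: deg flip: P_def)
  have root: "poly P (v i) = 0" if "i \<in> I" for i
    using that fin by (auto simp: P_def poly_prod)
  have qi: "q i = (\<Prod>j\<in>I - {i}. [:- v j, 1:])" if "i \<in> I" for i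
  proof -
    have "[:- v i, 1:] * q i = P"
      using synthetic_div_correct'[of "v i" P] root[OF that] by (simp add: q_def)
    also have "\<dots> = [:- v i, 1:] * (\<Prod>j\<in>I - {i}. [:- v j, 1:])"
      unfolding P_def by (rule prod.remove[OF fin that])
    finally show ?thesis
      by (metis mult_cancel_left one_neq_zero pCons_eq_0_iff)
  qed
  have pd: "pderiv P = (\<Sum>i\<in>I. q i)"
    unfolding P_def by (subst pderiv_prod) (auto intro!: sum.cong simp: qi pderiv_pCons)
  have step: "coeff (q i) k = coeff P (Suc k) + v i * coeff (q i) (Suc k)" for i k
    using arg_cong[OF synthetic_div_correct[of P "v i"], of "\<lambda>p. coeff p (Suc k)"]
    by (simp add: q_def)
  have step0: "coeff P 0 + v i * coeff (q i) 0 = 0" if "i \<in> I" for i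
    using arg_cong[OF synthetic_div_correct[of P "v i"], of "\<lambda>p. coeff p 0"] root[OF that]
    by (simp add: q_def)
  \<comment> \<open>Coefficient \<open>k\<close> of \<open>P\<close> is recovered from a weighted
    sum by dividing by \<open>k - n\<close>, which is nonzero below the leading coefficient.\<close>
  have newton: "(\<Sum>i\<in>I. v i * coeff (q i) k) = (of_nat k - of_nat n) * coeff P k" for k
  proof (cases k)
    case 0
    have "(\<Sum>i\<in>I. v i * coeff (q i) 0) = (\<Sum>i\<in>I. - coeff P 0)"
      using step0 by (intro sum.cong) (auto simp: eq_neg_iff_add_eq_0 add.commute)
    then show ?thesis using 0 by (simp add: n_def)
  next
    case (Suc m)
    have "of_nat k * coeff P k = (\<Sum>i\<in>I. coeff (q i) m)"
      using arg_cong[OF pd, of "\<lambda>p. coeff p m"] by (simp add: coeff_pderiv coeff_sum Suc)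
    also have "\<dots> = of_nat n * coeff P k + (\<Sum>i\<in>I. v i * coeff (q i) k)"
      unfolding Suc by (subst step) (simp add: sum.distrib n_def)
    finally show ?thesis by (simp add: algebra_simps)
  qed
  have high: "coeff P k \<in> \<rat> \<and> (\<forall>e. (\<Sum>i\<in>I. v i ^ e * coeff (q i) k) \<in> \<rat>)" if "k \<ge> n" for k
  proof (cases "n = 0")
    case True
    then have "I = {}" using fin by (simp add: n_def)
    then show ?thesis by (auto simp: P_def coeff_1)
  next
    case False
    have "coeff (q i) k = 0" for i
      using False that by (intro coeff_eq_0) (simp add: q_def degree_synthetic_div deg)
    moreover have "coeff P k \<in> \<rat>"
      using that lead coeff_eq_0[of P k] deg by (cases "k = n") auto
    ultimately show ?thesis by simp
  qed
  \<comment> \<open>Downward induction from the leading coefficient. The exponent \<open>e\<close>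
    is quantified because each step down in \<open>q i\<close> costs one more factor
    \<open>v i\<close>.\<close>
  have "coeff P k \<in> \<rat> \<and> (\<forall>e. (\<Sum>i\<in>I. v i ^ e * coeff (q i) k) \<in> \<rat>)" for k
  proof (cases "k \<le> n")
    case True
    then show ?thesis
    proof (induction k rule: inc_induct)
      case base show ?case by (rule high) simp
    next
      case (step k)
      have S: "(\<Sum>i\<in>I. v i ^ e * coeff (q i) k) \<in> \<rat>" for e
      proof -
        have eq: "(\<Sum>i\<in>I. v i ^ e * coeff (q i) k) =
            coeff P (Suc k) * (\<Sum>i\<in>I. v i ^ e) + (\<Sum>i\<in>I. v i ^ Suc e * coeff (q i) (Suc k))"
          by (subst \<open>\<And>k i. coeff (q i) k = _\<close>)
            (simp add: algebra_simps sum.distrib sum_distrib_left)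
        show ?thesis unfolding eq
          by (rule Rats_add[OF Rats_mult[OF step.IH[THEN conjunct1] ps] step.IH[THEN conjunct2, rule_format]])
      qed
      have "coeff P k = (\<Sum>i\<in>I. v i ^ 1 * coeff (q i) k) / (of_nat k - of_nat n)"
        using newton[of k] step.hyps by (simp add: field_simps)
      then have "coeff P k \<in> \<rat>"
        using S[of 1] by (metis Rats_diff Rats_divide Rats_of_nat)
      then show ?case using S by blast
    qed
  qed (use high in auto)
  then show ?thesis unfolding P_def by blast
qed

section \<open>Rational polynomial functions of the permuted roots\<close>

text \<open>
  The functions \<open>\<sigma> \<mapsto> p (\<theta> (\<sigma> 1), \<dots>, \<theta> (\<sigma> n))\<close> for rational polynomials \<open>p\<close> in \<open>n\<close> variables.
\<close>

inductive_set root_functions :: "nat \<Rightarrow> (nat \<Rightarrow> complex) \<Rightarrow> ((nat \<Rightarrow> nat) \<Rightarrow> complex) set"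
  for n \<theta> where
  const: "c \<in> \<rat> \<Longrightarrow> (\<lambda>_. c) \<in> root_functions n \<theta>"
| add: "F \<in> root_functions n \<theta> \<Longrightarrow> H \<in> root_functions n \<theta> \<Longrightarrow>
    (\<lambda>\<sigma>. F \<sigma> + H \<sigma>) \<in> root_functions n \<theta>"
| coord: "i \<in> {1..n} \<Longrightarrow> F \<in> root_functions n \<theta> \<Longrightarrow>
    (\<lambda>\<sigma>. \<theta> (\<sigma> i) * F \<sigma>) \<in> root_functions n \<theta>"

lemma root_functions_scale:
  assumes "F \<in> root_functions n \<theta>" "c \<in> \<rat>"
  shows "(\<lambda>\<sigma>. c * F \<sigma>) \<in> root_functions n \<theta>"
  using assms(1)
proof induction
  case (const d) then show ?case using assms(2) by (auto intro: root_functions.const)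
next
  case (add F H) then show ?case by (auto simp: distrib_left intro: root_functions.add)
next
  case (coord i F) then show ?case
    using root_functions.coord[of i n _ \<theta>] by (auto simp: mult.left_commute[of c])
qed

text \<open>The generating rules multiply by one root at a time, which lets a later induction absorb
  that root into an exponent; general products are recovered here.\<close>

lemma root_functions_mult:
  assumes "F \<in> root_functions n \<theta>" "H \<in> root_functions n \<theta>"
  shows "(\<lambda>\<sigma>. F \<sigma> * H \<sigma>) \<in> root_functions n \<theta>"
  using assms(1)
proof induction
  case (const d) then show ?case using assms(2) by (auto intro: root_functions_scale)
next
  case (add F H) then show ?case by (auto simp: distrib_right intro: root_functions.add)
next
  case (coord i F) then show ?case by (auto simp: mult.assoc intro: root_functions.coord)
qed

lemma root_functions_root: "i \<in> {1..n} \<Longrightarrow> (\<lambda>\<sigma>. \<theta> (\<sigma> i)) \<in> root_functions n \<theta>"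
  using root_functions.coord[OF _ root_functions.const[of 1]] by auto

lemma root_functions_diff:
  assumes "F \<in> root_functions n \<theta>" "H \<in> root_functions n \<theta>"
  shows "(\<lambda>\<sigma>. F \<sigma> - H \<sigma>) \<in> root_functions n \<theta>"
  using root_functions.add[OF assms(1) root_functions_scale[OF assms(2), of "-1"]] by simp

lemma root_functions_power:
  assumes "F \<in> root_functions n \<theta>"
  shows "(\<lambda>\<sigma>. F \<sigma> ^ k) \<in> root_functions n \<theta>"
  by (induction k) (auto intro: root_functions.const root_functions_mult assms)

lemma root_functions_poly:
  assumes "F \<in> root_functions n \<theta>" "\<And>k. coeff p k \<in> \<rat>"
  shows "(\<lambda>\<sigma>. poly p (F \<sigma>)) \<in> root_functions n \<theta>"
  using assms(2)
proof (induction p)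
  case 0 show ?case by (simp add: root_functions.const)
next
  case (pCons a p)
  have "a \<in> \<rat>" using pCons.prems[of 0] by simp
  moreover have "coeff p k \<in> \<rat>" for k using pCons.prems[of "Suc k"] by simp
  ultimately show ?case using pCons.IH assms(1)
    by (auto intro!: root_functions.add root_functions.const root_functions_mult)
qed

lemma root_functions_prod:
  assumes "finite I" "\<And>i. i \<in> I \<Longrightarrow> F i \<in> root_functions n \<theta>"
  shows "(\<lambda>\<sigma>. \<Prod>i\<in>I. F i \<sigma>) \<in> root_functions n \<theta>"
  using assms by induction (auto intro: root_functions.const root_functions_mult)

text \<open>Composition on the right merely renames the variables. It turns a relation between the
  roots into a statement about values at other permutations, and all group properties below rest on
  it.\<close>

lemma root_functions_compose:
  assumes "F \<in> root_functions n \<theta>" "\<tau> permutes {1..n}"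
  shows "(\<lambda>\<sigma>. F (\<sigma> \<circ> \<tau>)) \<in> root_functions n \<theta>"
  using assms(1)
proof induction
  case (coord i F)
  then show ?case using root_functions.coord[of "\<tau> i" n] permutes_in_image[OF assms(2), of i] by auto
qed (auto intro: root_functions.const root_functions.add)

section \<open>Symmetric functions of the roots are rational\<close>

text \<open>By Newton this amounts to the monic polynomial with root list \<theta> being rational,
  but power sums are the form that the next induction consumes. The \<theta> i may repeat;
  distinctness is demanded only where automorphisms are matched with permutations.\<close>

locale rational_power_sums =
  fixes n :: nat and \<theta> :: "nat \<Rightarrow> complex"
  assumes psum: "(\<Sum>i\<in>{1..n}. \<theta> i ^ e) \<in> \<rat>"
begin

text \<open>
  The sum over the value at a new index \<open>a\<close> is a full power sum minus the terms of the values already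
  taken, and each of these merges the exponent of \<open>a\<close> with that of an old index.
\<close>

lemma sum_injections_in_Rats:
  fixes S :: "nat set"
  assumes "finite S"
  shows "(\<Sum>f\<in>{f \<in> S \<rightarrow>\<^sub>E {1..n}. inj_on f S}. \<Prod>i\<in>S. \<theta> (f i) ^ e i) \<in> \<rat>"
  using assms
proof (induction S arbitrary: e)
  case empty show ?case by simp
next
  case (insert a S)
  define In where "In S = {f \<in> S \<rightarrow>\<^sub>E {1..n}. inj_on f S}" for S :: "nat set"
  have finIn: "finite (In T)" if "finite T" for T
    unfolding In_def by (rule finite_subset[OF _ finite_PiE[OF that, of "\<lambda>_. {1..n}"]]) auto
  have "(\<Sum>f\<in>In (insert a S). \<Prod>i\<in>insert a S. \<theta> (f i) ^ e i) =
    (\<Sum>(f, x)\<in>Sigma (In S) (\<lambda>f. {1..n} - f ` S). \<theta> x ^ e a * (\<Prod>i\<in>S. \<theta> (f i) ^ e i))"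
  proof (rule sum.reindex_bij_witness[of _ "\<lambda>(f, x). f(a := x)" "\<lambda>f. (restrict f S, f a)"], goal_cases)
    case (1 f)
    then show ?case by (auto simp: In_def fun_eq_iff PiE_def extensional_def)
  next
    case (2 f)
    then show ?case using insert.hyps by (auto simp: In_def inj_on_def)
  next
    case (3 y)
    obtain f x where y: "y = (f, x)" by (cases y)
    have "f \<in> extensional S" using 3 by (auto simp: y In_def PiE_def)
    then have "restrict (f(a := x)) S = f"
      using insert.hyps by (auto simp: fun_eq_iff extensional_def)
    then show ?case by (simp add: y)
  next
    case (4 y)
    obtain f x where y: "y = (f, x)" by (cases y)
    have f: "f \<in> S \<rightarrow>\<^sub>E {1..n}" "inj_on f S" and x: "x \<in> {1..n}" "x \<notin> f ` S"
      using 4 by (auto simp: y In_def)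
    have "inj_on (f(a := x)) (insert a S)"
      using f(2) x(2) insert.hyps by (auto simp: inj_on_def)
    then show ?case using f(1) x(1) by (simp add: y In_def PiE_fun_upd)
  next
    case (5 f)
    then show ?case using insert.hyps by auto
  qed
  also have "\<dots> = (\<Sum>f\<in>In S. (\<Sum>x\<in>{1..n} - f ` S. \<theta> x ^ e a) * (\<Prod>i\<in>S. \<theta> (f i) ^ e i))"
    by (subst sum.Sigma[symmetric]) (auto simp: finIn insert.hyps sum_distrib_right)
  also have "\<dots> = (\<Sum>f\<in>In S. (\<Sum>x\<in>{1..n}. \<theta> x ^ e a) * (\<Prod>i\<in>S. \<theta> (f i) ^ e i)
      - (\<Sum>j\<in>S. \<Prod>i\<in>S. \<theta> (f i) ^ (e(j := e j + e a)) i))"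
  proof (intro sum.cong refl)
    fix f assume f: "f \<in> In S"
    have "(\<Sum>x\<in>{1..n} - f ` S. \<theta> x ^ e a) = (\<Sum>x\<in>{1..n}. \<theta> x ^ e a) - (\<Sum>x\<in>f ` S. \<theta> x ^ e a)"
      using f by (intro sum_diff) (auto simp: In_def PiE_def)
    also have "(\<Sum>x\<in>f ` S. \<theta> x ^ e a) = (\<Sum>j\<in>S. \<theta> (f j) ^ e a)"
      using f by (subst sum.reindex) (auto simp: In_def)
    finally have 1: "(\<Sum>x\<in>{1..n} - f ` S. \<theta> x ^ e a) =
      (\<Sum>x\<in>{1..n}. \<theta> x ^ e a) - (\<Sum>j\<in>S. \<theta> (f j) ^ e a)" .
    have 2: "(\<Prod>i\<in>S. \<theta> (f i) ^ (e(j := e j + e a)) i) = \<theta> (f j) ^ e a * (\<Prod>i\<in>S. \<theta> (f i) ^ e i)"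
      if "j \<in> S" for j
      using that insert.hyps by (simp add: prod.remove[of S j] power_add mult_ac)
    show "(\<Sum>x\<in>{1..n} - f ` S. \<theta> x ^ e a) * (\<Prod>i\<in>S. \<theta> (f i) ^ e i) =
        (\<Sum>x\<in>{1..n}. \<theta> x ^ e a) * (\<Prod>i\<in>S. \<theta> (f i) ^ e i)
      - (\<Sum>j\<in>S. \<Prod>i\<in>S. \<theta> (f i) ^ (e(j := e j + e a)) i)"
      unfolding 1 by (simp add: 2 left_diff_distrib sum_distrib_right del: fun_upd_apply)
  qed
  also have "\<dots> = (\<Sum>x\<in>{1..n}. \<theta> x ^ e a) * (\<Sum>f\<in>In S. \<Prod>i\<in>S. \<theta> (f i) ^ e i)
      - (\<Sum>j\<in>S. \<Sum>f\<in>In S. \<Prod>i\<in>S. \<theta> (f i) ^ (e(j := e j + e a)) i)"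
    by (simp add: sum_subtractf sum_distrib_left del: fun_upd_apply) (rule sum.swap)
  also have "\<dots> \<in> \<rat>"
    using psum insert.IH[folded In_def] by (intro Rats_diff Rats_mult Rats_sum[of _ "\<lambda>j. \<Sum>f\<in>In S. _ f j"]) blast+
  finally show ?case unfolding In_def .
qed

lemma sum_permutations_in_Rats:
  "(\<Sum>\<sigma> | \<sigma> permutes {1..n}. \<Prod>i\<in>{1..n}. \<theta> (\<sigma> i) ^ e i) \<in> \<rat>"
proof -
  have "(\<Sum>\<sigma> | \<sigma> permutes {1..n}. \<Prod>i\<in>{1..n}. \<theta> (\<sigma> i) ^ e i) =
    (\<Sum>f\<in>{f \<in> {1..n} \<rightarrow>\<^sub>E {1..n}. inj_on f {1..n}}. \<Prod>i\<in>{1..n}. \<theta> (f i) ^ e i)"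
  proof (rule sum.reindex_bij_witness[of _ "\<lambda>f i. if i \<in> {1..n} then f i else i"
        "\<lambda>\<sigma>. restrict \<sigma> {1..n}"], goal_cases)
    case (1 \<sigma>)
    then show ?case by (auto simp: fun_eq_iff permutes_def)
  next
    case (2 \<sigma>)
    then have "inj_on \<sigma> {1..n}" "\<And>i. i \<in> {1..n} \<Longrightarrow> \<sigma> i \<in> {1..n}"
      by (auto simp: permutes_inj_on permutes_in_image simp del: atLeastAtMost_iff)
    then show ?case by (auto simp: inj_on_def simp del: atLeastAtMost_iff)
  next
    case (3 f)
    then show ?case by (auto simp: fun_eq_iff PiE_def extensional_def)
  next
    case (4 f)
    then have "f ` {1..n} = {1..n}" by (intro endo_inj_surj) auto
    with 4 have "bij_betw f {1..n} {1..n}" by (auto simp: bij_betw_def)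
    then have "bij_betw (\<lambda>i. if i \<in> {1..n} then f i else i) {1..n} {1..n}"
      by (subst bij_betw_cong[where g = f]) auto
    then show ?case by (auto intro!: bij_imp_permutes)
  qed auto
  then show ?thesis using sum_injections_in_Rats[of "{1..n}" e] by simp
qed

text \<open>The symmetric function theorem, in the form of a sum over the whole symmetric
  group.\<close>

lemma sum_root_function_in_Rats:
  assumes "F \<in> root_functions n \<theta>"
  shows "(\<Sum>\<sigma> | \<sigma> permutes {1..n}. F \<sigma>) \<in> \<rat>"
proof -
  \<comment> \<open>The extra monomial makes the induction close: in the case \<open>coord\<close>
    the new factor raises \<open>e i\<close> by one.\<close>
  have "(\<Sum>\<sigma> | \<sigma> permutes {1..n}. F \<sigma> * (\<Prod>i\<in>{1..n}. \<theta> (\<sigma> i) ^ e i)) \<in> \<rat>" for e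
    using assms
  proof (induction arbitrary: e)
    case (const c)
    then show ?case
      using sum_permutations_in_Rats[of e] by (simp flip: sum_distrib_left)
  next
    case (add F H)
    then show ?case by (simp add: distrib_right sum.distrib)
  next
    case (coord i F)
    have "(\<Prod>j\<in>{1..n}. \<theta> (\<sigma> j) ^ (e(i := Suc (e i))) j) = \<theta> (\<sigma> i) * (\<Prod>i\<in>{1..n}. \<theta> (\<sigma> i) ^ e i)" for \<sigma>
      using coord.hyps by (subst (1 2) prod.remove[of "{1..n}" i]) (auto simp: mult_ac)
    then show ?case using coord.IH[of "e(i := Suc (e i))"] by (simp add: mult_ac del: fun_upd_apply)
  qed
  from this[of "\<lambda>_. 0"] show ?thesis by simp
qed

end

section \<open>The group of relation-preserving permutations\<close>

text \<open>Otherwise the two polynomials are coprime over the rationals, and their Bezout identity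
  evaluated at \<open>x\<close> reads 0 = 1.\<close>

lemma irreducible_dvd_if_common_root:
  fixes p q :: "rat poly" and x :: complex
  assumes "Factorial_Ring.irreducible p" "poly (map_poly of_rat p) x = 0" "poly (map_poly of_rat q) x = 0"
  shows "p dvd q"
proof (rule ccontr)
  assume "\<not> p dvd q"
  then have "coprime p q"
    using assms(1) by (simp add: prime_elem_imp_coprime irreducible_imp_prime_elem)
  then obtain r s where "r * p + s * q = 1"
    by (metis bezout_coefficients_fst_snd coprime_iff_gcd_eq_1)
  then have "map_poly of_rat (r * p + s * q) = (1 :: complex poly)" by simp
  then have "poly (map_poly of_rat (r * p + s * q)) x = 1" by simp
  moreover have "map_poly of_rat (r * p + s * q) =
      map_poly of_rat r * map_poly of_rat p + map_poly of_rat s * (map_poly of_rat q :: complex poly)"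
    by (intro poly_eqI)
       (simp add: coeff_map_poly coeff_mult of_rat_add of_rat_sum of_rat_mult)
  ultimately show False using assms(2,3) by simp
qed

context rational_power_sums
begin

lemma char_poly_in_Rats:
  assumes "F \<in> root_functions n \<theta>"
  shows "coeff (\<Prod>\<sigma> | \<sigma> permutes {1..n}. [:- F \<sigma>, 1:]) k \<in> \<rat>"
  by (intro coeffs_in_Rats_if_power_sums)
     (use sum_root_function_in_Rats[OF root_functions_power[OF assms]] in \<open>auto simp: finite_permutations\<close>)

text \<open>Write the polynomial with roots \<open>F \<sigma>\<close> as X^m q with q(0) nonzero.
  Then q(F \<sigma>) / q(0) is 1 where \<open>F \<sigma> = 0\<close>; where
  \<open>F \<sigma>\<close> is nonzero, it must be a root of q.\<close>

lemma zero_set_indicator: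
  assumes "F \<in> root_functions n \<theta>"
  obtains H where "H \<in> root_functions n \<theta>"
    "\<And>\<sigma>. \<sigma> permutes {1..n} \<Longrightarrow> H \<sigma> = (if F \<sigma> = 0 then 1 else 0)"
proof -
  define P where "P = (\<Prod>\<sigma> | \<sigma> permutes {1..n}. [:- F \<sigma>, 1:])"
  have fin: "finite {\<sigma>. \<sigma> permutes {1..n}}" by (simp add: finite_permutations)
  have "P \<noteq> 0" using fin by (simp add: P_def prod_zero_iff)
  then obtain q where q: "P = [:-0, 1:] ^ order 0 P * q" "\<not> [:-0, 1:] dvd q"
    using order_decomp by blast
  define m where "m = order 0 P"
  have Pq: "P = monom 1 m * q"
    using q(1) by (simp add: m_def monom_altdef)
  have q0: "poly q 0 \<noteq> 0" using q(2) by (simp add: poly_eq_0_iff_dvd)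
  have "coeff q k \<in> \<rat>" for k
  proof -
    have "coeff P (m + k) = coeff q k" by (simp add: Pq coeff_monom_mult)
    then show ?thesis using char_poly_in_Rats[OF assms, of "m + k"] by (simp add: P_def)
  qed
  then have "(\<lambda>\<sigma>. inverse (poly q 0) * poly q (F \<sigma>)) \<in> root_functions n \<theta>"
    by (intro root_functions_scale root_functions_poly assms) (auto simp: poly_0_coeff_0 intro: Rats_inverse)
  moreover have "inverse (poly q 0) * poly q (F \<sigma>) = (if F \<sigma> = 0 then 1 else 0)"
    if "\<sigma> permutes {1..n}" for \<sigma>
  proof -
    have "poly P (F \<sigma>) = 0" using that fin by (auto simp: P_def poly_prod)
    then have "F \<sigma> ^ m * poly q (F \<sigma>) = 0" by (simp add: Pq poly_monom)
    then show ?thesis using q0 by auto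
  qed
  ultimately show ?thesis by (rule that)
qed

text \<open>The Galois group of the splitting field, acting on the indices of the roots.\<close>

definition galois_perms :: "(nat \<Rightarrow> nat) set" where
  "galois_perms = {\<sigma>. \<sigma> permutes {1..n} \<and> (\<forall>F\<in>root_functions n \<theta>. F id = 0 \<longrightarrow> F \<sigma> = 0)}"

lemma finite_galois_perms: "finite galois_perms"
  unfolding galois_perms_def by (simp add: finite_permutations)

lemma galois_perms_eqD:
  assumes "\<sigma> \<in> galois_perms" "F \<in> root_functions n \<theta>" "H \<in> root_functions n \<theta>" "F id = H id"
  shows "F \<sigma> = H \<sigma>"
proof -
  have "F \<sigma> - H \<sigma> = 0"
    using assms root_functions_diff[OF assms(2,3)] by (auto simp: galois_perms_def)
  then show ?thesis by simp
qed

lemma galois_perms_comp: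
  assumes "\<sigma> \<in> galois_perms" "\<tau> \<in> galois_perms"
  shows "\<sigma> \<circ> \<tau> \<in> galois_perms"
proof -
  have "F (\<sigma> \<circ> \<tau>) = 0" if "F \<in> root_functions n \<theta>" "F id = 0" for F
    using galois_perms_eqD[OF assms(1) root_functions_compose[OF that(1), of \<tau>] root_functions.const[of 0]]
      assms(2) that by (auto simp: galois_perms_def)
  then show ?thesis using assms by (auto simp: galois_perms_def permutes_compose)
qed

lemma id_in_galois_perms: "id \<in> galois_perms"
  by (simp add: galois_perms_def permutes_id)

lemma subgroup_galois_perms: "subgroup galois_perms (sym_group n)"
proof -
  interpret S: group "sym_group n" by (rule sym_group_is_group)
  have "inv' \<sigma> \<in> galois_perms" if \<sigma>: "\<sigma> \<in> galois_perms" for \<sigma>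
  proof -
    have p: "\<sigma> permutes {1..n}" using \<sigma> by (simp add: galois_perms_def)
    \<comment> \<open>In a finite set closed under composition, left translation is injective, hence
      onto, and so reaches the identity.\<close>
    have "inj_on (\<lambda>\<tau>. \<sigma> \<circ> \<tau>) galois_perms"
      by (intro inj_onI) (metis comp_assoc id_comp permutes_inv_o(2)[OF p])
    moreover have "(\<lambda>\<tau>. \<sigma> \<circ> \<tau>) ` galois_perms \<subseteq> galois_perms"
      using galois_perms_comp[OF \<sigma>] by blast
    ultimately have "(\<lambda>\<tau>. \<sigma> \<circ> \<tau>) ` galois_perms = galois_perms"
      by (intro endo_inj_surj finite_galois_perms)
    then obtain \<tau> where "\<tau> \<in> galois_perms" "\<sigma> \<circ> \<tau> = id"
      using id_in_galois_perms by (metis imageE)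
    then show ?thesis by (metis comp_assoc id_comp comp_id permutes_inv_o(2)[OF p])
  qed
  note inv_closed = this
  have sub: "galois_perms \<subseteq> carrier (sym_group n)"
    by (auto simp: galois_perms_def sym_group_carrier)
  show ?thesis
  proof (rule S.subgroupI)
    show "galois_perms \<noteq> {}" using id_in_galois_perms by blast
    show "inv\<^bsub>sym_group n\<^esub> \<sigma> \<in> galois_perms" if "\<sigma> \<in> galois_perms" for \<sigma>
      using inv_closed[OF that] sub that by (metis subsetD sym_group_inv_equality)
    show "\<sigma> \<otimes>\<^bsub>sym_group n\<^esub> \<tau> \<in> galois_perms" if "\<sigma> \<in> galois_perms" "\<tau> \<in> galois_perms" for \<sigma> \<tau>
      using galois_perms_comp[OF that] by (simp add: sym_group_mult)
  qed (rule sub)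
qed

text \<open>A permutation outside the group breaks some relation \<open>F id = 0\<close>. The
  indicator of the zeros of that \<open>F\<close> is 0 there and 1 on the group; the product over
  all outsiders is the indicator sought.\<close>

lemma galois_perms_indicator:
  obtains H where "H \<in> root_functions n \<theta>"
    "\<And>\<sigma>. \<sigma> permutes {1..n} \<Longrightarrow> H \<sigma> = (if \<sigma> \<in> galois_perms then 1 else 0)"
proof -
  define N where "N = {\<sigma>. \<sigma> permutes {1..n}} - galois_perms"
  have finN: "finite N" by (simp add: N_def finite_permutations)
  have "\<exists>H\<in>root_functions n \<theta>. H \<sigma> = 0 \<and> (\<forall>\<tau>\<in>galois_perms. H \<tau> = 1) \<and>
      (\<forall>\<tau>. \<tau> permutes {1..n} \<longrightarrow> H \<tau> \<in> {0, 1})" if "\<sigma> \<in> N" for \<sigma>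
  proof -
    obtain F where F: "F \<in> root_functions n \<theta>" "F id = 0" "F \<sigma> \<noteq> 0"
      using \<open>\<sigma> \<in> N\<close> by (auto simp: N_def galois_perms_def)
    obtain H where H: "H \<in> root_functions n \<theta>"
      "\<And>\<sigma>. \<sigma> permutes {1..n} \<Longrightarrow> H \<sigma> = (if F \<sigma> = 0 then 1 else 0)"
      using zero_set_indicator[OF F(1)] by blast
    have "H \<sigma> = 0" using \<open>\<sigma> \<in> N\<close> F H by (auto simp: N_def)
    moreover have "H \<tau> = 1" if "\<tau> \<in> galois_perms" for \<tau>
      using that F H by (auto simp: galois_perms_def)
    ultimately show ?thesis using H by (intro bexI[of _ H]) auto
  qed
  then obtain H where H: "\<And>\<sigma>. \<sigma> \<in> N \<Longrightarrow> H \<sigma> \<in> root_functions n \<theta>"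
    "\<And>\<sigma>. \<sigma> \<in> N \<Longrightarrow> H \<sigma> \<sigma> = 0" "\<And>\<sigma> \<tau>. \<sigma> \<in> N \<Longrightarrow> \<tau> \<in> galois_perms \<Longrightarrow> H \<sigma> \<tau> = 1"
    by metis
  show ?thesis
  proof (rule that)
    show "(\<lambda>\<tau>. \<Prod>\<sigma>\<in>N. H \<sigma> \<tau>) \<in> root_functions n \<theta>"
      using finN H(1) by (rule root_functions_prod)
    show "(\<Prod>\<sigma>\<in>N. H \<sigma> \<tau>) = (if \<tau> \<in> galois_perms then 1 else 0)" if "\<tau> permutes {1..n}" for \<tau>
    proof (cases "\<tau> \<in> galois_perms")
      case False
      then have "\<tau> \<in> N" using that by (simp add: N_def)
      then show ?thesis using False finN H(2) by (auto simp: prod_zero_iff)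
    qed (use H(3) in simp)
  qed
qed

lemma sum_galois_perms_in_Rats:
  assumes "F \<in> root_functions n \<theta>"
  shows "(\<Sum>\<sigma>\<in>galois_perms. F \<sigma>) \<in> \<rat>"
proof -
  obtain H where H: "H \<in> root_functions n \<theta>"
    "\<And>\<sigma>. \<sigma> permutes {1..n} \<Longrightarrow> H \<sigma> = (if \<sigma> \<in> galois_perms then 1 else 0)"
    by (rule galois_perms_indicator) blast
  have "(\<Sum>\<sigma>\<in>galois_perms. F \<sigma>) = (\<Sum>\<sigma> | \<sigma> permutes {1..n}. H \<sigma> * F \<sigma>)"
    by (rule sum.mono_neutral_cong_left) (auto simp: finite_permutations galois_perms_def H(2))
  also have "\<dots> \<in> \<rat>" by (intro sum_root_function_in_Rats root_functions_mult H assms)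
  finally show ?thesis .
qed

text \<open>Values on the group are roots because relations are preserved. Conversely, the product
  of X - F \<sigma> over the group is rational and vanishes at \<open>F id\<close>, so it is a
  multiple of \<open>p\<close>.\<close>

lemma galois_perms_conjugates:
  assumes "Factorial_Ring.irreducible p" "F \<in> root_functions n \<theta>"
    and "poly (map_poly of_rat p) (F id) = 0"
  shows "F ` galois_perms = {y. poly (map_poly of_rat p) y = 0}"
proof (intro equalityI subsetI)
  fix y assume "y \<in> F ` galois_perms"
  then obtain \<sigma> where "\<sigma> \<in> galois_perms" "y = F \<sigma>" by blast
  moreover have "(\<lambda>\<sigma>. poly (map_poly of_rat p) (F \<sigma>)) \<in> root_functions n \<theta>"
    using assms(2) by (intro root_functions_poly) (auto simp: coeff_map_poly)
  ultimately show "y \<in> {y. poly (map_poly of_rat p) y = 0}"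
    using assms(3) by (auto simp: galois_perms_def)
next
  fix y :: complex assume y: "y \<in> {y. poly (map_poly of_rat p) y = 0}"
  define P where "P = (\<Prod>\<sigma>\<in>galois_perms. [:- F \<sigma>, 1:])"
  have "coeff P k \<in> \<rat>" for k unfolding P_def
    by (rule coeffs_in_Rats_if_power_sums[OF finite_galois_perms
          sum_galois_perms_in_Rats[OF root_functions_power[OF assms(2)]]])
  then obtain Q where Q: "P = map_poly of_rat Q" using ratpolyE[of P] by metis
  have "poly P (F id) = 0"
    using id_in_galois_perms finite_galois_perms by (auto simp: P_def poly_prod)
  then have "p dvd Q" using assms Q by (intro irreducible_dvd_if_common_root) auto
  then obtain R where "Q = p * R" by blast
  then have "P = map_poly of_rat p * map_poly of_rat R"
    unfolding Q by (intro poly_eqI) (simp add: coeff_map_poly coeff_mult of_rat_sum of_rat_mult)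
  then have "poly P y = 0" using y by simp
  then have "(\<Prod>\<sigma>\<in>galois_perms. y - F \<sigma>) = 0" by (simp add: P_def poly_prod)
  then obtain \<sigma> where "\<sigma> \<in> galois_perms" "y - F \<sigma> = 0"
    using finite_galois_perms by (auto simp only: prod_zero_iff)
  then show "y \<in> F ` galois_perms" by (simp add: image_iff) metis
qed

text \<open>An orbit-stabiliser count: the fibre of \<open>F\<close> over \<open>F g\<close> is the
  left translate by \<open>g\<close> of the fibre over \<open>F id\<close>, so all fibres have the
  same size.\<close>

lemma card_image_galois_perms_dvd:
  assumes "F \<in> root_functions n \<theta>"
  shows "card (F ` galois_perms) dvd card galois_perms"
proof -
  define fib where "fib y = {\<sigma> \<in> galois_perms. F \<sigma> = y}" for y
  interpret S: group "sym_group n" by (rule sym_group_is_group)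
  interpret G: subgroup galois_perms "sym_group n" by (rule subgroup_galois_perms)
  have *: "card (fib (F g)) = card (fib (F id))" if g: "g \<in> galois_perms" for g
  proof -
    have gp: "g permutes {1..n}" using g by (simp add: galois_perms_def)
    have inv: "inv' g \<in> galois_perms"
      using G.m_inv_closed[OF g] g by (simp add: galois_perms_def sym_group_carrier)
    have fwd: "g \<circ> \<sigma> \<in> fib (F g)" if "\<sigma> \<in> fib (F id)" for \<sigma>
      using galois_perms_eqD[OF g root_functions_compose[OF assms, of \<sigma>] assms] that galois_perms_comp[OF g]
      by (auto simp: fib_def galois_perms_def)
    have bwd: "inv' g \<circ> \<sigma> \<in> fib (F id)" if "\<sigma> \<in> fib (F g)" for \<sigma>
    proof -
      have \<sigma>: "\<sigma> \<in> galois_perms" "\<sigma> permutes {1..n}" "F \<sigma> = F g"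
        using that by (auto simp: fib_def galois_perms_def)
      \<comment> \<open>\<open>D\<close> vanishes at \<open>g\<close>, whereas the group preserves
        relations that hold at the identity. Renaming the variables by \<open>g\<close> and applying
        the inverse of \<open>g\<close> transports the zero to the identity.\<close>
      define D where "D = (\<lambda>\<rho>. F (\<rho> \<circ> (inv' g \<circ> \<sigma>)) - F \<rho>)"
      have ip: "(inv' g \<circ> \<sigma>) permutes {1..n}"
        using \<sigma>(2) gp by (intro permutes_compose permutes_inv)
      have D: "D \<in> root_functions n \<theta>" unfolding D_def
        using root_functions_diff[OF root_functions_compose[OF assms ip] assms] .
      have "D g = 0"
        using \<sigma>(3) permutes_inv_o(1)[OF gp] by (simp add: D_def flip: comp_assoc)
      have D': "(\<lambda>\<rho>. D (\<rho> \<circ> g)) \<in> root_functions n \<theta>" by (rule root_functions_compose[OF D gp])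
      have "D (inv' g \<circ> g) = 0"
        using galois_perms_eqD[OF inv D' root_functions.const[of 0]] \<open>D g = 0\<close> by simp
      then have "D id = 0" using permutes_inv_o(2)[OF gp] by simp
      then show ?thesis using galois_perms_comp[OF inv \<sigma>(1)] by (simp add: D_def fib_def)
    qed
    have "bij_betw (\<lambda>\<sigma>. g \<circ> \<sigma>) (fib (F id)) (fib (F g))"
      by (rule bij_betw_byWitness[where f' = "\<lambda>\<sigma>. inv' g \<circ> \<sigma>"])
         (use fwd bwd permutes_inv_o[OF gp] in \<open>auto simp: comp_assoc[symmetric]\<close>)
    then show ?thesis by (metis bij_betw_same_card)
  qed
  have "card galois_perms = (\<Sum>y\<in>F ` galois_perms. card (fib y))"
    unfolding fib_def card_eq_sum using finite_galois_perms by (rule sum.image_gen)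
  also have "\<dots> = card (F ` galois_perms) * card (fib (F id))"
    by (subst sum.cong[where h = "\<lambda>_. card (fib (F id))"]) (use * in auto)
  finally show ?thesis by simp
qed

end

section \<open>The splitting field as the Galois closure\<close>

lemma complex_ring_simps [simp]:
  "carrier complex_ring = UNIV" "x \<otimes>\<^bsub>complex_ring\<^esub> y = x * y" "x \<oplus>\<^bsub>complex_ring\<^esub> y = x + y"
  "\<one>\<^bsub>complex_ring\<^esub> = 1" "\<zero>\<^bsub>complex_ring\<^esub> = 0"
  by (simp_all add: ring_of_type_algebra_def)

lemma complex_ring_uminus [simp]: "\<ominus>\<^bsub>complex_ring\<^esub> x = - x"
proof -
  interpret field complex_ring by (rule field_from_type_algebra)
  show ?thesis by (rule minus_equality) auto
qed

lemma complex_ring_inv [simp]: "x \<noteq> 0 \<Longrightarrow> inv\<^bsub>complex_ring\<^esub> x = inverse x"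
proof -
  interpret field complex_ring by (rule field_from_type_algebra)
  assume "x \<noteq> 0"
  then show ?thesis by (intro comm_inv_char) auto
qed

lemma subfield_complex_iff:
  "subfield K complex_ring \<longleftrightarrow>
     1 \<in> K \<and> (\<forall>x\<in>K. \<forall>y\<in>K. x + y \<in> K \<and> x * y \<in> K) \<and> (\<forall>x\<in>K. - x \<in> K \<and> inverse x \<in> K)"
    (is "_ \<longleftrightarrow> ?R")
proof
  interpret field complex_ring by (rule field_from_type_algebra)
  assume K: "subfield K complex_ring"
  note R = subringE[OF subfieldE(1)[OF K]]
  have "inverse x \<in> K" if "x \<in> K" for x
    using subfield_m_inv(1)[OF K, of x] that R(2) by (cases "x = 0") auto
  then show ?R using R by auto
next
  interpret field complex_ring by (rule field_from_type_algebra)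
  assume R: ?R
  have "subring K complex_ring" using R by (intro subringI) auto
  then show "subfield K complex_ring" using R by (intro subfieldI') auto
qed

lemma Rats_subset_subfield:
  assumes "subfield K complex_ring"
  shows "\<rat> \<subseteq> K"
proof
  note K = assms[unfolded subfield_complex_iff]
  have "0 \<in> K" using K by (metis add.right_inverse)
  have nat: "of_nat k \<in> K" for k
    by (induction k) (use K \<open>0 \<in> K\<close> in auto)
  have int: "of_int k \<in> K" for k
    by (cases k rule: int_cases2) (use nat K in auto)
  fix x :: complex assume "x \<in> \<rat>"
  then obtain a b where "x = of_int a / of_int b" by (auto elim!: Rats_cases')
  then show "x \<in> K" using int K by (simp add: divide_inverse)
qed

context rational_power_sums
begin

text \<open>By construction only the ring generated over the rationals by the roots; that it is a
  field follows from its elements being algebraic.\<close>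

definition splitting_field :: "complex set" where
  "splitting_field = (\<lambda>F. F id) ` root_functions n \<theta>"

lemma splitting_fieldE:
  assumes "x \<in> splitting_field"
  obtains F where "F \<in> root_functions n \<theta>" "F id = x"
  using assms unfolding splitting_field_def by blast

lemma splitting_fieldI: "F \<in> root_functions n \<theta> \<Longrightarrow> F id \<in> splitting_field"
  unfolding splitting_field_def by blast

lemma root_in_splitting_field: "i \<in> {1..n} \<Longrightarrow> \<theta> i \<in> splitting_field"
  using splitting_fieldI[OF root_functions_root] by fastforce

lemma splitting_field_algebraic:
  assumes "x \<in> splitting_field"
  obtains p :: "rat poly" where "p \<noteq> 0" "poly (map_poly of_rat p) x = 0"
proof -
  obtain F where F: "F \<in> root_functions n \<theta>" "F id = x" using splitting_fieldE[OF assms] .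
  define P where "P = (\<Prod>\<sigma> | \<sigma> permutes {1..n}. [:- F \<sigma>, 1:])"
  have fin: "finite {\<sigma>. \<sigma> permutes {1..n}}" by (simp add: finite_permutations)
  have "P \<noteq> 0" using fin by (simp add: P_def prod_zero_iff)
  obtain Q where Q: "P = map_poly of_rat Q"
    using ratpolyE[of P] char_poly_in_Rats[OF F(1)] unfolding P_def by metis
  have "(\<Prod>\<sigma> | \<sigma> permutes {1..n}. x - F \<sigma>) = 0"
    using fin F(2) permutes_id[of "{1..n}"] by (intro prod_zero bexI[of _ id]) auto
  then have "poly P x = 0" by (simp add: P_def poly_prod)
  then show ?thesis using Q \<open>P \<noteq> 0\<close> by (intro that[of Q]) auto
qed

lemma splitting_field_ring:
  assumes "x \<in> splitting_field" "y \<in> splitting_field"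
  shows "x + y \<in> splitting_field" "x * y \<in> splitting_field" "- x \<in> splitting_field"
proof -
  obtain F where F: "F \<in> root_functions n \<theta>" "F id = x" using splitting_fieldE[OF assms(1)] .
  obtain H where H: "H \<in> root_functions n \<theta>" "H id = y" using splitting_fieldE[OF assms(2)] .
  show "x + y \<in> splitting_field"
    using splitting_fieldI[OF root_functions.add[OF F(1) H(1)]] F(2) H(2) by simp
  show "x * y \<in> splitting_field"
    using splitting_fieldI[OF root_functions_mult[OF F(1) H(1)]] F(2) H(2) by simp
  show "- x \<in> splitting_field"
    using splitting_fieldI[OF root_functions_scale[OF F(1), of "-1"]] F(2) by simp
qed

text \<open>After removing powers of X, a rational polynomial a + X r(X) with a nonzero vanishes at
  \<open>x\<close>, so the inverse is - r(x) / a, again a polynomial in \<open>x\<close>.\<close>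

lemma splitting_field_inverse:
  assumes "x \<in> splitting_field"
  shows "inverse x \<in> splitting_field"
proof (cases "x = 0")
  case False
  obtain F where F: "F \<in> root_functions n \<theta>" "F id = x" using splitting_fieldE[OF assms] .
  obtain H where H: "H \<in> root_functions n \<theta>"
    "\<And>\<sigma>. \<sigma> permutes {1..n} \<Longrightarrow> H \<sigma> = (if F \<sigma> = 0 then 1 else 0)"
    using zero_set_indicator[OF F(1)] by blast
  obtain p :: "rat poly" where p: "p \<noteq> 0" "poly (map_poly of_rat p) x = 0"
    using splitting_field_algebraic[OF assms] .
  define m where "m = order 0 p"
  obtain q where q: "p = [:-0, 1:] ^ m * q" "\<not> [:-0, 1:] dvd q"
    using order_decomp[OF p(1)] unfolding m_def by blast
  have pq: "p = monom 1 m * q" using q(1) by (simp add: monom_altdef)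
  obtain a r where ar: "q = pCons a r" by (cases q)
  have "a \<noteq> 0" using q(2) unfolding ar by (auto simp: dvd_iff_poly_eq_0)
  have "map_poly of_rat p = monom 1 m * (map_poly of_rat q :: complex poly)"
    unfolding pq by (intro poly_eqI) (simp add: coeff_map_poly coeff_monom_mult)
  then have "poly (map_poly of_rat q) x = 0"
    using p(2) False by (simp add: poly_monom)
  then have "of_rat a + x * poly (map_poly of_rat r) x = 0"
    by (simp add: ar map_poly_pCons)
  then have "of_rat (inverse a) * of_rat a = - (of_rat (inverse a) * (x * poly (map_poly of_rat r) x))"
    by (simp add: add_eq_0_iff2)
  then have "x * (- of_rat (inverse a) * poly (map_poly of_rat r) x) = 1"
    using \<open>a \<noteq> 0\<close> by (simp add: mult_ac flip: of_rat_mult)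
  then have "inverse x = - of_rat (inverse a) * poly (map_poly of_rat r) (F id)"
    unfolding F(2) by (rule inverse_unique)
  also have "\<dots> \<in> splitting_field"
    by (rule splitting_fieldI)
       (intro root_functions_scale root_functions_poly F(1), auto simp: coeff_map_poly)
  finally show ?thesis .
qed (use assms in auto)

lemma subfield_splitting_field: "subfield splitting_field complex_ring"
  unfolding subfield_complex_iff
  using splitting_field_ring splitting_field_inverse splitting_fieldI[OF root_functions.const[of 1]]
  by auto

text \<open>A conjugate of \<open>F id\<close> has the form \<open>F \<sigma>\<close>, which is the
  value at the identity of the root function with variables renamed by \<sigma>.\<close>

lemma normal_splitting_field: "normal_over_rat splitting_field"
  unfolding normal_over_rat_def
proof (intro conjI ballI allI impI)
  show "subfield splitting_field complex_ring" by (rule subfield_splitting_field)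
next
  fix x assume "x \<in> splitting_field"
  then obtain p :: "rat poly" where "p \<noteq> 0" "poly (map_poly of_rat p) x = 0"
    by (rule splitting_field_algebraic)
  then show "Polynomial.algebraic x"
    by (intro algebraicI'[of "map_poly of_rat p"]) (auto simp: coeff_map_poly poly_eq_iff)
next
  fix p :: "rat poly"
  assume p: "Factorial_Ring.irreducible p \<and> (\<exists>x\<in>splitting_field. poly (map_poly of_rat p) x = 0)"
  then obtain F where F: "F \<in> root_functions n \<theta>" "poly (map_poly of_rat p) (F id) = 0"
    by (auto elim: splitting_fieldE)
  show "{x. poly (map_poly of_rat p) x = 0} \<subseteq> splitting_field"
  proof
    fix y :: complex assume "y \<in> {x. poly (map_poly of_rat p) x = 0}"
    then obtain \<sigma> where \<sigma>: "\<sigma> \<in> galois_perms" "y = F \<sigma>"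
      using galois_perms_conjugates[OF _ F] p by blast
    then show "y \<in> splitting_field"
      using splitting_fieldI[OF root_functions_compose[OF F(1), of \<sigma>]]
      by (simp add: galois_perms_def)
  qed
qed

lemma splitting_field_subset:
  assumes "subfield K complex_ring" "\<And>i. i \<in> {1..n} \<Longrightarrow> \<theta> i \<in> K"
  shows "splitting_field \<subseteq> K"
proof
  note K = assms(1)[unfolded subfield_complex_iff]
  fix x assume "x \<in> splitting_field"
  then obtain F where "F \<in> root_functions n \<theta>" "F id = x" by (rule splitting_fieldE)
  moreover have "F id \<in> K" if "F \<in> root_functions n \<theta>" for F
    using that by induction (use Rats_subset_subfield[OF assms(1)] assms(2) K in auto)
  ultimately show "x \<in> K" by blast
qed

text \<open>Irreducibility lets one root suffice: a normal field containing it contains all the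
  others.\<close>

lemma galois_closure_rat_adjoin:
  assumes "Factorial_Ring.irreducible p" "{x. poly (map_poly of_rat p) x = 0} = \<theta> ` {1..n}"
    and "i \<in> {1..n}"
  shows "galois_closure (rat_adjoin (\<theta> i)) = splitting_field"
proof
  interpret field complex_ring by (rule field_from_type_algebra)
  have "rat_adjoin (\<theta> i) \<subseteq> splitting_field"
    unfolding rat_adjoin_def
    using subfield_splitting_field root_in_splitting_field[OF assms(3)]
    by (intro generate_field_min_subfield1) auto
  then show "galois_closure (rat_adjoin (\<theta> i)) \<subseteq> splitting_field"
    unfolding galois_closure_def using normal_splitting_field by blast
  show "splitting_field \<subseteq> galois_closure (rat_adjoin (\<theta> i))"
    unfolding galois_closure_def
  proof (intro Inter_greatest)
    fix L assume "L \<in> {L. normal_over_rat L \<and> rat_adjoin (\<theta> i) \<subseteq> L}"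
    then have L: "normal_over_rat L" "rat_adjoin (\<theta> i) \<subseteq> L" by auto
    have "\<theta> i \<in> L" using L(2) generate_field.incl[of "\<theta> i" "{\<theta> i}" complex_ring]
      by (auto simp: rat_adjoin_def)
    moreover have "poly (map_poly of_rat p) (\<theta> i) = 0" using assms(2,3) by auto
    ultimately have "\<theta> ` {1..n} \<subseteq> L" using L(1) assms(1,2) by (auto simp: normal_over_rat_def)
    then show "splitting_field \<subseteq> L"
      using L(1) by (intro splitting_field_subset) (auto simp: normal_over_rat_def)
  qed
qed

section \<open>Permutations of the roots as field automorphisms\<close>

text \<open>The choice of \<open>F\<close> is harmless: two representations of \<open>x\<close>
  differ by a relation, which \<sigma> preserves. The restriction makes the map extensional, as
  membership in \<open>Bij\<close> requires.\<close>

definition perm_aut :: "(nat \<Rightarrow> nat) \<Rightarrow> complex \<Rightarrow> complex" where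
  "perm_aut \<sigma> = (\<lambda>x\<in>splitting_field. (SOME F. F \<in> root_functions n \<theta> \<and> F id = x) \<sigma>)"

lemma perm_aut_eq:
  assumes "\<sigma> \<in> galois_perms" "F \<in> root_functions n \<theta>"
  shows "perm_aut \<sigma> (F id) = F \<sigma>"
proof -
  define H where "H = (SOME H. H \<in> root_functions n \<theta> \<and> H id = F id)"
  have "H \<in> root_functions n \<theta> \<and> H id = F id"
    unfolding H_def by (rule someI[of _ F]) (use assms(2) in auto)
  then have "H \<sigma> = F \<sigma>" using galois_perms_eqD[OF assms(1) _ assms(2)] by blast
  then show ?thesis using splitting_fieldI[OF assms(2)] by (simp add: perm_aut_def H_def)
qed

text \<open>The order is kept: \<tau> sends \<open>F id\<close> to \<open>F \<tau>\<close>, the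
  value at the identity of a renamed function, and \<sigma> sends this to
  \<open>F (\<sigma> \<circ> \<tau>)\<close>.\<close>

lemma perm_aut_compose:
  assumes "\<sigma> \<in> galois_perms" "\<tau> \<in> galois_perms"
  shows "perm_aut (\<sigma> \<circ> \<tau>) = compose splitting_field (perm_aut \<sigma>) (perm_aut \<tau>)"
proof
  fix x
  show "perm_aut (\<sigma> \<circ> \<tau>) x = compose splitting_field (perm_aut \<sigma>) (perm_aut \<tau>) x"
  proof (cases "x \<in> splitting_field")
    case True
    then obtain F where F: "F \<in> root_functions n \<theta>" "F id = x" by (rule splitting_fieldE)
    have "\<tau> permutes {1..n}" using assms(2) by (simp add: galois_perms_def)
    from perm_aut_eq[OF assms(1) root_functions_compose[OF F(1) this]]
    have "perm_aut \<sigma> (F \<tau>) = F (\<sigma> \<circ> \<tau>)" by simp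
    then show ?thesis
      using True F perm_aut_eq[OF assms(2) F(1)] perm_aut_eq[OF galois_perms_comp[OF assms] F(1)]
      by (simp add: compose_def)
  qed (simp add: perm_aut_def compose_def)
qed

lemma perm_aut_id: "perm_aut id = (\<lambda>x\<in>splitting_field. x)"
proof
  fix x show "perm_aut id x = (\<lambda>x\<in>splitting_field. x) x"
  proof (cases "x \<in> splitting_field")
    case True
    then obtain F where F: "F \<in> root_functions n \<theta>" "F id = x" by (rule splitting_fieldE)
    then show ?thesis using perm_aut_eq[OF id_in_galois_perms F(1)] True by simp
  qed (simp add: perm_aut_def)
qed

lemma perm_aut_mem:
  assumes "\<sigma> \<in> galois_perms" "x \<in> splitting_field"
  shows "perm_aut \<sigma> x \<in> splitting_field"
proof -
  obtain F where F: "F \<in> root_functions n \<theta>" "F id = x" using splitting_fieldE[OF assms(2)] .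
  have "\<sigma> permutes {1..n}" using assms(1) by (simp add: galois_perms_def)
  then show ?thesis
    using splitting_fieldI[OF root_functions_compose[OF F(1)], of \<sigma>] perm_aut_eq[OF assms(1) F(1)] F(2)
    by simp
qed

lemma perm_aut_Bij:
  assumes "\<sigma> \<in> galois_perms"
  shows "perm_aut \<sigma> \<in> Bij splitting_field"
proof -
  interpret G: subgroup galois_perms "sym_group n" by (rule subgroup_galois_perms)
  have p: "\<sigma> permutes {1..n}" using assms by (simp add: galois_perms_def)
  have inv: "inv' \<sigma> \<in> galois_perms"
    using G.m_inv_closed[OF assms] p by (simp add: sym_group_carrier)
  have "perm_aut (inv' \<sigma>) (perm_aut \<sigma> x) = x" if "x \<in> splitting_field" for x
    using fun_cong[OF perm_aut_compose[OF inv assms], of x] that permutes_inv_o(2)[OF p]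
    by (simp add: perm_aut_id compose_def)
  moreover have "perm_aut \<sigma> (perm_aut (inv' \<sigma>) x) = x" if "x \<in> splitting_field" for x
    using fun_cong[OF perm_aut_compose[OF assms inv], of x] that permutes_inv_o(1)[OF p]
    by (simp add: perm_aut_id compose_def)
  ultimately have "bij_betw (perm_aut \<sigma>) splitting_field splitting_field"
    using perm_aut_mem[OF assms] perm_aut_mem[OF inv]
    by (intro bij_betw_byWitness[where f' = "perm_aut (inv' \<sigma>)"]) auto
  then show ?thesis by (simp add: Bij_def perm_aut_def)
qed

lemma perm_aut_ring:
  assumes "\<sigma> \<in> galois_perms" "x \<in> splitting_field" "y \<in> splitting_field"
  shows "perm_aut \<sigma> (x + y) = perm_aut \<sigma> x + perm_aut \<sigma> y"
    "perm_aut \<sigma> (x * y) = perm_aut \<sigma> x * perm_aut \<sigma> y"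
proof -
  obtain F where F: "F \<in> root_functions n \<theta>" "F id = x" using splitting_fieldE[OF assms(2)] .
  obtain H where H: "H \<in> root_functions n \<theta>" "H id = y" using splitting_fieldE[OF assms(3)] .
  note e = perm_aut_eq[OF assms(1) F(1)] perm_aut_eq[OF assms(1) H(1)]
  show "perm_aut \<sigma> (x + y) = perm_aut \<sigma> x + perm_aut \<sigma> y"
    using perm_aut_eq[OF assms(1) root_functions.add[OF F(1) H(1)]] e F(2) H(2) by simp
  show "perm_aut \<sigma> (x * y) = perm_aut \<sigma> x * perm_aut \<sigma> y"
    using perm_aut_eq[OF assms(1) root_functions_mult[OF F(1) H(1)]] e F(2) H(2) by simp
qed

lemma perm_aut_of_rat: "\<sigma> \<in> galois_perms \<Longrightarrow> perm_aut \<sigma> (of_rat q) = of_rat q"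
  using perm_aut_eq[OF _ root_functions.const[of "of_rat q"]] by simp

lemma perm_aut_in_carrier:
  assumes "\<sigma> \<in> galois_perms"
  shows "perm_aut \<sigma> \<in> carrier (rat_automorphism_group splitting_field)"
  unfolding rat_automorphism_group_def
  using perm_aut_Bij[OF assms] perm_aut_of_rat[OF assms, of 1]
  by (auto simp: ring_hom_def perm_aut_mem perm_aut_ring perm_aut_of_rat assms)

text \<open>An automorphism permutes the roots of the rational polynomial \<open>P\<close>, and the
  values on the roots determine it. The assumption \<open>all\<close> places the induced index
  permutation in the group.\<close>

lemma rat_automorphism_is_perm_aut:
  assumes inj: "inj_on \<theta> {1..n}" and all: "galois_perms = {\<sigma>. \<sigma> permutes {1..n}}"
    and \<alpha>: "\<alpha> \<in> carrier (rat_automorphism_group splitting_field)"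
  shows "\<alpha> \<in> perm_aut ` galois_perms"
proof -
  define P where "P = (\<Prod>i\<in>{1..n}. [:- \<theta> i, 1:])"
  have bij: "\<alpha> \<in> Bij splitting_field" and ratq: "\<And>q. \<alpha> (of_rat q) = of_rat q"
    and ring: "\<And>x y. x \<in> splitting_field \<Longrightarrow> y \<in> splitting_field \<Longrightarrow>
      \<alpha> (x + y) = \<alpha> x + \<alpha> y \<and> \<alpha> (x * y) = \<alpha> x * \<alpha> y"
    using \<alpha> by (auto simp: rat_automorphism_group_def ring_hom_def)
  have rats: "\<alpha> c = c" "c \<in> splitting_field" if "c \<in> \<rat>" for c
    using that ratq splitting_fieldI[OF root_functions.const[OF that]] by (auto elim!: Rats_cases)
  have injL: "inj_on \<alpha> splitting_field" using bij by (simp add: Bij_def bij_betw_def)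
  have polyL: "poly p x \<in> splitting_field \<and> \<alpha> (poly p x) = poly p (\<alpha> x)"
    if x: "x \<in> splitting_field" and "\<And>k. coeff p k \<in> \<rat>" for p x
    using that(2)
  proof (induction p)
    case 0 show ?case using rats[of 0] by simp
  next
    case (pCons a p)
    have "a \<in> \<rat>" using pCons.prems[of 0] by simp
    moreover have "coeff p k \<in> \<rat>" for k using pCons.prems[of "Suc k"] by simp
    ultimately show ?case
      using pCons.IH rats[of a] ring x splitting_field_ring by simp
  qed
  have Prat: "coeff P k \<in> \<rat>" for k
    unfolding P_def by (rule coeffs_in_Rats_if_power_sums[OF finite_atLeastAtMost psum])
  have "\<exists>j\<in>{1..n}. \<alpha> (\<theta> i) = \<theta> j" if i: "i \<in> {1..n}" for i
  proof -
    have "poly P (\<theta> i) = 0" unfolding P_def poly_prod using i by (intro prod_zero) auto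
    then have "poly P (\<alpha> (\<theta> i)) = 0"
      using polyL[OF root_in_splitting_field[OF i] Prat] rats[of 0] by simp
    then have "(\<Prod>j\<in>{1..n}. \<alpha> (\<theta> i) - \<theta> j) = 0" by (simp add: P_def poly_prod)
    then show ?thesis by (auto simp: prod_zero_iff)
  qed
  then obtain s where s: "\<And>i. i \<in> {1..n} \<Longrightarrow> s i \<in> {1..n} \<and> \<alpha> (\<theta> i) = \<theta> (s i)" by metis
  define \<sigma> where "\<sigma> i = (if i \<in> {1..n} then s i else i)" for i
  have "inj_on \<sigma> {1..n}"
  proof (rule inj_onI)
    fix i j assume ij: "i \<in> {1..n}" "j \<in> {1..n}" "\<sigma> i = \<sigma> j"
    then have "\<alpha> (\<theta> i) = \<alpha> (\<theta> j)" using s by (simp add: \<sigma>_def)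
    then have "\<theta> i = \<theta> j" using injL ij root_in_splitting_field by (auto dest: inj_onD)
    then show "i = j" using inj ij by (auto dest: inj_onD)
  qed
  moreover have "\<sigma> ` {1..n} \<subseteq> {1..n}" using s by (auto simp: \<sigma>_def)
  ultimately have "bij_betw \<sigma> {1..n} {1..n}"
    unfolding bij_betw_def using endo_inj_surj[of "{1..n}" \<sigma>] by blast
  then have \<sigma>p: "\<sigma> permutes {1..n}" by (rule bij_imp_permutes) (simp add: \<sigma>_def del: atLeastAtMost_iff)
  then have \<sigma>g: "\<sigma> \<in> galois_perms" using all by blast
  have \<alpha>F: "\<alpha> (F id) = F \<sigma>" if "F \<in> root_functions n \<theta>" for F
    using that
  proof induction
    case (const c) then show ?case using rats by simp
  next
    case (add F H)
    then show ?case
      using ring[OF splitting_fieldI[OF add.hyps(1)] splitting_fieldI[OF add.hyps(2)]]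
      by (simp only: add.IH)
  next
    case (coord i F)
    have "\<alpha> (\<theta> i) = \<theta> (\<sigma> i)" using s[OF coord.hyps(1)] coord.hyps(1) by (simp add: \<sigma>_def)
    then have "\<alpha> (\<theta> i * F id) = \<theta> (\<sigma> i) * F \<sigma>"
      using ring[OF root_in_splitting_field[OF coord.hyps(1)] splitting_fieldI[OF coord.hyps(2)]]
      by (simp only: coord.IH)
    then show ?case by (simp add: id_def)
  qed
  have "\<alpha> = perm_aut \<sigma>"
  proof
    fix x show "\<alpha> x = perm_aut \<sigma> x"
    proof (cases "x \<in> splitting_field")
      case True
      then obtain F where "F \<in> root_functions n \<theta>" "F id = x" by (rule splitting_fieldE)
      then show ?thesis using \<alpha>F perm_aut_eq[OF \<sigma>g] by metis
    next
      case False
      then show ?thesis using bij by (simp add: Bij_def extensional_def perm_aut_def)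
    qed
  qed
  then show ?thesis using \<sigma>g by blast
qed

lemma rat_automorphism_group_iso_sym_group:
  assumes inj: "inj_on \<theta> {1..n}" and all: "galois_perms = {\<sigma>. \<sigma> permutes {1..n}}"
  shows "rat_automorphism_group splitting_field \<cong> sym_group n"
proof -
  have car: "carrier (sym_group n) = galois_perms"
    using all by (auto simp: sym_group_carrier)
  have "inj_on perm_aut galois_perms"
  proof (rule inj_onI)
    fix \<sigma> \<tau> assume st: "\<sigma> \<in> galois_perms" "\<tau> \<in> galois_perms" "perm_aut \<sigma> = perm_aut \<tau>"
    have p: "\<sigma> permutes {1..n}" "\<tau> permutes {1..n}" using st all by auto
    show "\<sigma> = \<tau>"
    proof
      fix i show "\<sigma> i = \<tau> i"
      proof (cases "i \<in> {1..n}")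
        case True
        note F = root_functions_root[OF True, of \<theta>]
        have "\<theta> (\<sigma> i) = \<theta> (\<tau> i)"
          using perm_aut_eq[OF st(1) F] perm_aut_eq[OF st(2) F] st(3) by simp
        then show ?thesis
          using inj True p by (auto dest!: inj_onD simp: permutes_in_image simp del: atLeastAtMost_iff)
      next
        case False
        then show ?thesis using p by (simp add: permutes_not_in del: atLeastAtMost_iff)
      qed
    qed
  qed
  moreover have "perm_aut ` galois_perms = carrier (rat_automorphism_group splitting_field)"
    using perm_aut_in_carrier rat_automorphism_is_perm_aut[OF inj all] by blast
  moreover have "perm_aut \<in> hom (sym_group n) (rat_automorphism_group splitting_field)"
    unfolding hom_def car
    using perm_aut_in_carrier perm_aut_Bij
    by (auto simp: sym_group_mult perm_aut_compose rat_automorphism_group_def BijGroup_def)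
  ultimately have "perm_aut \<in> iso (sym_group n) (rat_automorphism_group splitting_field)"
    by (simp add: iso_def car bij_betw_def)
  then have "sym_group n \<cong> rat_automorphism_group splitting_field"
    unfolding is_iso_def by blast
  then show ?thesis by (rule group.iso_sym[OF sym_group_is_group])
qed

end

section \<open>Rational roots and irreducibility\<close>

lemma linear_dvd_imp_root:
  fixes p s :: "'a :: Fields.field poly"
  assumes "s dvd p" "degree s = 1"
  obtains x where "poly p x = 0"
proof -
  obtain d c where "s = [:c, d:]" "d \<noteq> 0" using assms(2) by (rule degree1_coeffs)
  then have "poly s (- c / d) = 0" by simp
  moreover obtain t where "p = s * t" using assms(1) unfolding dvd_def by blast
  ultimately have "poly p (- c / d) = 0" by simp
  then show ?thesis by (rule that)
qed

lemma irreducible_if_no_root: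
  fixes p :: "'a :: Fields.field poly"
  assumes deg: "degree p = 2 \<or> degree p = 3" and nr: "\<And>x. poly p x \<noteq> 0"
  shows "Factorial_Ring.irreducible p"
proof (rule irreducibleI)
  show "p \<noteq> 0" using deg by auto
  show "\<not> p dvd 1" unfolding is_unit_iff_degree[OF \<open>p \<noteq> 0\<close>] using deg by presburger
  fix q r assume pqr: "p = q * r"
  have lin: "degree s \<noteq> 1" if "s dvd p" for s
    using linear_dvd_imp_root[OF that] nr by metis
  have nz: "q \<noteq> 0" "r \<noteq> 0" using pqr \<open>p \<noteq> 0\<close> by auto
  then have "degree q + degree r = degree p" using pqr by (simp add: degree_mult_eq)
  moreover have "degree q \<noteq> 1" "degree r \<noteq> 1" using lin pqr by auto
  ultimately have "degree q = 0 \<or> degree r = 0" using deg by auto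
  then show "q dvd 1 \<or> r dvd 1" using nz by (auto simp: is_unit_iff_degree)
qed

lemma rat_root_monic_int_is_int:
  fixes x :: rat
  assumes "poly (map_poly of_int p) x = 0" "lead_coeff p = 1"
  obtains z :: int where "x = of_int z"
proof -
  have "algebraic_int x" using assms unfolding algebraic_int_altdef_ipoly by blast
  moreover have "x \<in> \<rat>" by (cases x) (auto simp: Fract_of_int_quotient)
  ultimately show ?thesis using rational_algebraic_int_is_int that by (auto elim!: Ints_cases)
qed

text \<open>Every prime occurs in \<open>b\<close> at most once, so it is enough that it divides
  \<open>x\<close>.\<close>

lemma squarefree_dvd_powerD:
  fixes b x :: int
  assumes "squarefree b" "b dvd x ^ n"
  shows "b dvd x"
proof (cases "x = 0")
  case False
  have "b \<noteq> 0" using assms(1) by auto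
  show ?thesis
  proof (rule multiplicity_le_imp_dvd)
    fix p :: int assume p: "Factorial_Ring.prime p"
    have "multiplicity p b \<le> 1"
      using assms(1) p by (auto simp: squarefree_factorial_semiring'' \<open>b \<noteq> 0\<close>)
    moreover have "multiplicity p x \<ge> 1" if "multiplicity p b = 1"
    proof -
      have "p dvd b" using that by (metis not_dvd_imp_multiplicity_0 zero_neq_one)
      then have "p dvd x ^ n" using assms(2) dvd_trans by blast
      then have "p dvd x" using p by (meson prime_dvd_power)
      then show ?thesis using p False
        by (metis Suc_eq_plus1 Suc_leI add_0 multiplicity_gt_zero_iff not_prime_unit One_nat_def)
    qed
    ultimately show "multiplicity p b \<le> multiplicity p x" by linarith
  qed (use \<open>b \<noteq> 0\<close> in auto)
qed simp

text \<open>The cubic below is the resolvent of \<open>x\<^sup>4 + b x + b\<close>; its three roots are the sums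
  \<open>\<theta>\<^sub>i \<theta>\<^sub>j + \<theta>\<^sub>k \<theta>\<^sub>l\<close> over the pairings of the four roots.\<close>

lemma resolvent_rat_root:
  fixes z :: rat
  assumes b: "squarefree b" and z: "z ^ 3 - 4 * of_int b * z - of_int b ^ 2 = 0"
  shows "b = 3 \<and> z = -3 \<or> b = 5 \<and> z = 5"
proof -
  define p :: "int poly" where "p = [:- (b ^ 2), - 4 * b, 0, 1:]"
  have "poly (map_poly of_int p) z = 0"
    using z by (simp add: p_def map_poly_pCons power2_eq_square power3_eq_cube algebra_simps)
  then obtain y :: int where y: "z = of_int y"
    by (rule rat_root_monic_int_is_int) (simp add: p_def)
  have "of_int (y ^ 3 - 4 * b * y - b ^ 2) = (0 :: rat)" using z y by simp
  then have yb: "y ^ 3 = b * (4 * y + b)"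
    unfolding of_int_eq_0_iff by (simp add: power2_eq_square algebra_simps)
  then have "b dvd y" using squarefree_dvd_powerD[OF b, of y 3] by simp
  then obtain k where k: "y = b * k" by blast
  have "b \<noteq> 0" using b by auto
  have "b ^ 2 * (b * k ^ 3) = b ^ 2 * (4 * k + 1)"
    using yb unfolding k by (simp add: power2_eq_square power3_eq_cube algebra_simps)
  then have bk: "b * k ^ 3 = 4 * k + 1" using \<open>b \<noteq> 0\<close> by simp
  \<comment> \<open>So \<open>k\<close> is a unit: 1 yields \<open>b = 5\<close> and
    \<open>z = 5\<close>, while -1 yields \<open>b = 3\<close> and \<open>z = -3\<close>.\<close>
  then have "k * (b * k ^ 2 - 4) = 1" by (simp add: power2_eq_square power3_eq_cube algebra_simps)
  then have "k = 1 \<or> k = -1" by (metis zmult_eq_1_iff)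
  then show ?thesis using bk k y by auto
qed

lemma quartic_no_rat_root:
  fixes x :: rat
  assumes b: "squarefree b"
  shows "x ^ 4 + of_int b * x + of_int b \<noteq> 0"
proof
  assume x: "x ^ 4 + of_int b * x + of_int b = 0"
  have "poly (map_poly of_int (quartic b b)) x = 0"
    using x by (simp add: quartic_def map_poly_pCons power4_eq_xxxx algebra_simps)
  then obtain y :: int where y: "x = of_int y"
    by (rule rat_root_monic_int_is_int) (simp add: quartic_def)
  have "of_int (y ^ 4 + b * y + b) = (0 :: rat)" using x y by simp
  then have yb: "y ^ 4 + b * y + b = 0" unfolding of_int_eq_0_iff .
  then have "y ^ 4 = b * (- y - 1)" by (simp add: algebra_simps)
  then have "b dvd y" using squarefree_dvd_powerD[OF b, of y 4] by simp
  then obtain k where k: "y = b * k" by blast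
  have "b \<noteq> 0" using b by auto
  have "b * (b ^ 3 * k ^ 4 + b * k + 1) = 0"
    using yb unfolding k by (simp add: power4_eq_xxxx power3_eq_cube algebra_simps)
  then have "b ^ 3 * k ^ 4 + b * k + 1 = 0" using \<open>b \<noteq> 0\<close> by simp
  \<comment> \<open>Both \<open>b * k\<close> and \<open>b\<close> divide 1, which leaves finitely
    many cases.\<close>
  then have *: "(b * k) * (- (b * b * k * k * k) - 1) = 1"
    by (simp add: power4_eq_xxxx power3_eq_cube algebra_simps)
  then have "y = 1 \<or> y = -1" unfolding k by (metis zmult_eq_1_iff)
  moreover have "b * (k * (- (b * b * k * k * k) - 1)) = 1" using * by (simp add: mult.assoc)
  then have "b = 1 \<or> b = -1" by (metis zmult_eq_1_iff)
  ultimately show False using yb by auto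
qed

text \<open>In a factorisation (x^2 + u x + v)(x^2 - u x + w) the square of u is a rational root of
  the resolvent cubic. Such roots are only -3 and 5, neither a rational square, so the quartic stays
  irreducible even for \<open>b\<close> equal to 3 or 5.\<close>

lemma quartic_irreducible:
  assumes b: "squarefree b"
  shows "Factorial_Ring.irreducible (map_poly rat_of_int (quartic b b))"
proof (rule irreducibleI)
  define p where "p = map_poly rat_of_int (quartic b b)"
  have p: "p = [:of_int b, of_int b, 0, 0, 1:]" by (simp add: p_def quartic_def map_poly_pCons)
  show "map_poly rat_of_int (quartic b b) \<noteq> 0" by (simp add: quartic_def map_poly_pCons)
  show "\<not> map_poly rat_of_int (quartic b b) dvd 1"
    by (simp add: quartic_def map_poly_pCons is_unit_iff_degree)
  fix q r assume "map_poly rat_of_int (quartic b b) = q * r"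
  then have pqr: "p = q * r" by (simp add: p_def)
  have nz: "q \<noteq> 0" "r \<noteq> 0" using pqr p by auto
  have lin: "degree s \<noteq> 1" if "s dvd p" for s
  proof
    assume "degree s = 1"
    with that obtain x where "poly p x = 0" by (rule linear_dvd_imp_root)
    then show False using quartic_no_rat_root[OF b, of x]
      by (simp add: p power4_eq_xxxx algebra_simps)
  qed
  have "degree p = 4" by (simp add: p)
  then have deg: "degree q + degree r = 4" using pqr nz by (simp add: degree_mult_eq)
  have "degree q \<noteq> 1" "degree r \<noteq> 1" using lin pqr by auto
  moreover have "\<not> (degree q = 2 \<and> degree r = 2)"
  proof
    assume "degree q = 2 \<and> degree r = 2"
    then obtain q0 q1 q2 r0 r1 r2 where qr: "q = [:q0, q1, q2:]" "r = [:r0, r1, r2:]"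
      using degree2_coeffs by metis
    have c: "q2 * r2 = 1" "q1 * r2 + q2 * r1 = 0" "q2 * r0 + q1 * r1 + q0 * r2 = 0"
      "q1 * r0 + q0 * r1 = of_int b" "q0 * r0 = of_int b"
      using pqr unfolding p qr by (auto simp: algebra_simps)
    \<comment> \<open>Coefficients of the monic normalisations of both factors, since
      \<open>q2 * r2 = 1\<close>.\<close>
    define u v w where "u = q1 * r2" and "v = q0 * r2" and "w = r0 * q2"
    have u': "u = - (q2 * r1)" using c(2) by (simp add: u_def add_eq_0_iff2)
    have "v * w = (q2 * r2) * (q0 * r0)" by (simp add: v_def w_def mult_ac)
    then have 1: "v * w = of_int b" by (simp only: c mult_1_left)
    have "u\<^sup>2 = (q1 * r2) * - (q2 * r1)" unfolding power2_eq_square using u' u_def by metis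
    also have "\<dots> = - ((q2 * r2) * (q1 * r1))" by (simp add: mult_ac)
    also have "\<dots> = v + w" using c(1,3) by (simp add: v_def w_def algebra_simps add_eq_0_iff2)
    finally have 2: "u\<^sup>2 = v + w" .
    have "u * (w - v) = (q1 * r2) * w - u * v" by (simp add: u_def algebra_simps)
    also have "\<dots> = (q2 * r2) * (q1 * r0 + q0 * r1)" unfolding u' by (simp add: v_def w_def algebra_simps)
    finally have 3: "u * (w - v) = of_int b" by (simp only: c mult_1_left)
    have "(u\<^sup>2) ^ 3 - 4 * of_int b * u\<^sup>2 - of_int b ^ 2 =
        u\<^sup>2 * ((u\<^sup>2)\<^sup>2 - 4 * (v * w)) - (u * (w - v))\<^sup>2"
      unfolding 1 3 by (simp add: power3_eq_cube power2_eq_square algebra_simps)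
    also have "\<dots> = u\<^sup>2 * ((v + w)\<^sup>2 - 4 * (v * w) - (w - v)\<^sup>2)"
      unfolding 2[symmetric] by (simp add: power2_eq_square algebra_simps)
    also have "\<dots> = 0" by (simp add: power2_eq_square algebra_simps)
    finally have "(u\<^sup>2) ^ 3 - 4 * of_int b * u\<^sup>2 - of_int b ^ 2 = 0" .
    then have "b = 3 \<and> u\<^sup>2 = -3 \<or> b = 5 \<and> u\<^sup>2 = 5" by (rule resolvent_rat_root[OF b])
    moreover have "u\<^sup>2 \<noteq> -3" using zero_le_power2[of u] by linarith
    ultimately have "u\<^sup>2 = 5" by blast
    then have "poly (map_poly of_int [:-5, 0, 1:]) u = 0"
      by (simp add: map_poly_pCons power2_eq_square)
    then obtain m :: int where m: "u = of_int m"
      by (rule rat_root_monic_int_is_int) simp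
    then have "of_int (m\<^sup>2) = (of_int 5 :: rat)" using \<open>u\<^sup>2 = 5\<close> by simp
    then have m2: "\<bar>m\<bar>\<^sup>2 = 5" unfolding of_int_eq_iff by simp
    have "\<bar>m\<bar> \<le> 2 \<or> \<bar>m\<bar> \<ge> 3" by linarith
    then have "\<bar>m\<bar>\<^sup>2 \<le> 2\<^sup>2 \<or> \<bar>m\<bar>\<^sup>2 \<ge> 3\<^sup>2" by (metis abs_ge_zero power_mono zero_le_numeral)
    then show False using m2 by simp
  qed
  ultimately have "degree q = 0 \<or> degree r = 0" using deg by linarith
  then show "q dvd 1 \<or> r dvd 1" using nz by (auto simp: is_unit_iff_degree)
qed

section \<open>The monogeneity hypotheses on the diagonal\<close>

text \<open>For a = b the gcd is \<bar>b\<bar>^3 times gcd(256, b), so for square-free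
  \<open>b\<close> the quotient is \<open>256 - 27 * b\<close> up to sign, halved if
  \<open>b\<close> is even. At a prime dividing \<open>b\<close>, the alternatives for 2 and 3 fail,
  as they require \<open>p\<close> not to divide \<open>b\<close> or a = b; what remains says that
  \<open>p^2\<close> does not divide \<open>b\<close>.\<close>

lemma monogeneity_hypotheses_iff:
  "monogeneity_hypotheses b b \<longleftrightarrow> squarefree b \<and> squarefree (256 - 27 * b)"
proof -
  \<comment> \<open>The gcd is normalised to be nonnegative whereas \<open>b ^ 3\<close> may be
    negative; this changes the quotient by a unit only.\<close>
  have div: "(c * (k * x)) div (\<bar>c\<bar> * k) = sgn c * x" if "c \<noteq> 0" "k \<noteq> 0" for c k x :: int
  proof -
    have "c * (k * x) = (\<bar>c\<bar> * k) * (sgn c * x)"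
      using abs_mult_sgn[of c] by (metis mult.commute mult.left_commute)
    then show ?thesis using that by (metis abs_0_eq mult_eq_0_iff nonzero_mult_div_cancel_left)
  qed
  have key: "squarefree ((256 * b ^ 3 - 27 * b ^ 4) div quartic_gcd b b) \<longleftrightarrow> squarefree (256 - 27 * b)"
    if b: "squarefree b"
  proof -
    have "b \<noteq> 0" using b by auto
    have "quartic_gcd b b = gcd (b ^ 3 * 256) (b ^ 3 * (27 * b))"
      unfolding quartic_gcd_def by (simp add: power4_eq_xxxx power3_eq_cube mult_ac)
    also have "\<dots> = \<bar>b ^ 3\<bar> * gcd 256 (27 * b)" by (simp add: gcd_mult_left abs_mult)
    also have "coprime ((2 :: int) ^ 8) 27" by (subst coprime_power_left_iff) simp
    then have "gcd 256 (27 * b) = gcd 256 b"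
      by (intro gcd_mult_right_left_cancel) simp
    finally have g: "quartic_gcd b b = \<bar>b ^ 3\<bar> * gcd 256 b" .
    have num: "256 * b ^ 3 - 27 * b ^ 4 = b ^ 3 * (256 - 27 * b)"
      by (simp add: power4_eq_xxxx power3_eq_cube algebra_simps)
    show ?thesis
    proof (cases "even b")
      case False
      then have "coprime (2 ^ 8) b" by (subst coprime_power_left_iff) simp
      then have "gcd 256 b = 1" by (simp add: coprime_iff_gcd_eq_1)
      then have "(256 * b ^ 3 - 27 * b ^ 4) div quartic_gcd b b = sgn (b ^ 3) * (256 - 27 * b)"
        unfolding g num using div[of "b ^ 3" 1 "256 - 27 * b"] \<open>b \<noteq> 0\<close> by simp
      then show ?thesis
        using squarefree_minus[of "256 - 27 * b"] \<open>b \<noteq> 0\<close> by (cases "b > 0") (auto simp: sgn_if)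
    next
      case True
      then obtain c where c: "b = 2 * c" by blast
      have "odd c"
      proof
        assume "even c"
        then have "2 ^ 2 dvd b" using c by auto
        then have "(2 :: int) dvd 1" by (rule squarefreeD[OF b])
        then show False by simp
      qed
      then have "coprime (2 ^ 7) c" by (subst coprime_power_left_iff) simp
      then have "gcd 128 c = 1" by (simp add: coprime_iff_gcd_eq_1)
      then have "gcd 256 b = 2" using gcd_mult_left[of 2 128 c] by (simp add: c)
      then have "(256 * b ^ 3 - 27 * b ^ 4) div quartic_gcd b b =
          (b ^ 3 * (2 * (128 - 27 * c))) div (\<bar>b ^ 3\<bar> * 2)"
        unfolding g num by (simp add: c algebra_simps)
      also have "\<dots> = sgn (b ^ 3) * (128 - 27 * c)"
        using \<open>b \<noteq> 0\<close> by (intro div) auto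
      finally have "squarefree ((256 * b ^ 3 - 27 * b ^ 4) div quartic_gcd b b) \<longleftrightarrow> squarefree (128 - 27 * c)"
        using squarefree_minus[of "128 - 27 * c"] \<open>b \<noteq> 0\<close> by (cases "b > 0") (auto simp: sgn_if)
      \<comment> \<open>As \<open>c\<close> is odd, so is \<open>128 - 27 * c\<close>, and a single
        factor 2 keeps it square-free.\<close>
      also have "\<dots> \<longleftrightarrow> squarefree (2 * (128 - 27 * c))"
      proof
        assume "squarefree (128 - 27 * c)"
        moreover have "coprime 2 (128 - 27 * c)" using \<open>odd c\<close> by simp
        moreover have "squarefree (2 :: int)" by (intro squarefree_prime) simp
        ultimately show "squarefree (2 * (128 - 27 * c))" by (intro squarefree_mult_coprime)
      qed (rule squarefree_multD)
      finally show ?thesis by (simp add: c algebra_simps)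
    qed
  qed
  have pb: "p dvd b" if "Factorial_Ring.prime p" "p dvd quartic_gcd b b" for p
  proof (rule ccontr)
    assume "\<not> p dvd b"
    then have "\<not> p dvd b ^ n" for n using that(1) by (meson prime_dvd_power)
    then have "p dvd 256" "p dvd 27"
      using that unfolding quartic_gcd_def by (auto simp: prime_dvd_mult_iff)
    \<comment> \<open>513 - 512 = 1, a Bezout identity for 27 and 256.\<close>
    then have "p dvd 27 * 19 - 256 * 2" by (intro dvd_diff dvd_mult2)
    then show False using that(1) by (simp add: not_prime_unit)
  qed
  show ?thesis
  proof
    assume m: "monogeneity_hypotheses b b"
    have "b \<noteq> 0"
      using m by (auto simp: monogeneity_hypotheses_def quartic_gcd_def)
    have "\<not> p\<^sup>2 dvd b" if p: "Factorial_Ring.prime p" for p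
    proof
      assume "p\<^sup>2 dvd b"
      then have "p dvd b" by (meson dvd_triv_left dvd_trans power2_eq_square dvd_power pos2)
      then have "p dvd quartic_gcd b b"
        unfolding quartic_gcd_def by (simp add: power3_eq_cube power4_eq_xxxx)
      then have "monogeneity_prime_condition b b p"
        using m p by (simp add: monogeneity_hypotheses_def)
      then show False
        using \<open>p dvd b\<close> \<open>p\<^sup>2 dvd b\<close> by (auto simp: monogeneity_prime_condition_def)
    qed
    then have "squarefree b" using squarefree_factorial_semiring[OF \<open>b \<noteq> 0\<close>] by blast
    moreover have "squarefree ((256 * b ^ 3 - 27 * b ^ 4) div quartic_gcd b b)"
      by (rule m[unfolded monogeneity_hypotheses_def, THEN conjunct1])
    ultimately show "squarefree b \<and> squarefree (256 - 27 * b)" by (simp only: key)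
  next
    assume b: "squarefree b \<and> squarefree (256 - 27 * b)"
    have "monogeneity_prime_condition b b p"
      if "Factorial_Ring.prime p" "p dvd quartic_gcd b b" for p
    proof -
      have "\<not> p\<^sup>2 dvd b" using that(1) squarefreeD[of b p] b by (auto simp: not_prime_unit)
      then show ?thesis using pb[OF that] by (simp add: monogeneity_prime_condition_def)
    qed
    then show "monogeneity_hypotheses b b"
      unfolding monogeneity_hypotheses_def
      by (intro conjI quartic_irreducible allI impI) (simp_all only: b key)
  qed
qed

section \<open>Subgroups of index two in the symmetric group\<close>

lemma three_cycle_cube:
  assumes "c \<in> three_cycles n"
  shows "c \<circ> c \<circ> c = id"
proof -
  obtain cs where cs: "c = cycle_of_list cs" "cycle cs" "length cs = 3" using assms by blast
  obtain x y z where xyz: "cs = [x, y, z]" using stupid_lemma[OF cs(3)] by blast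
  have "x \<noteq> y" "y \<noteq> z" "x \<noteq> z" using cs(2) xyz by auto
  then show ?thesis unfolding cs(1) xyz
    by (auto simp: fun_eq_iff Transposition.transpose_def)
qed

text \<open>A subgroup of index 2 contains all squares, and every 3-cycle is a square.\<close>

lemma half_subgroup_eq_alt_group:
  assumes H: "subgroup H (sym_group n)" and card: "2 * card H = fact n" and n: "n \<ge> 2"
  shows "H = carrier (alt_group n)"
proof -
  interpret S: group "sym_group n" by (rule sym_group_is_group)
  interpret A: group "alt_group n" by (rule alt_group_is_group)
  interpret H: subgroup H "sym_group n" by (rule H)
  have fin: "finite (carrier (sym_group n))"
    by (metis card.infinite fact_nonzero sym_group_card_carrier)
  have comp: "\<sigma> \<circ> \<tau> \<in> H" if "\<sigma> \<in> H" "\<tau> \<in> H" for \<sigma> \<tau>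
    using H.m_closed[OF that] by (simp add: sym_group_mult)
  have invH: "inv' \<sigma> \<in> H" if "\<sigma> \<in> H" for \<sigma>
    using H.m_inv_closed[OF that] H.mem_carrier[OF that] by simp
  \<comment> \<open>If \<open>g\<close> is not in \<open>H\<close>, then \<open>H\<close> and its
    translate by \<open>g\<close> fill the group; \<open>g \<circ> g\<close> in that translate would
    put \<open>g\<close> into \<open>H\<close>.\<close>
  have square: "g \<circ> g \<in> H" if g: "g permutes {1..n}" for g
  proof (rule ccontr)
    assume gg: "g \<circ> g \<notin> H"
    then have gH: "g \<notin> H" using comp by blast
    have disj: "H \<inter> (\<lambda>h. g \<circ> h) ` H = {}"
    proof (rule ccontr)
      assume "H \<inter> (\<lambda>h. g \<circ> h) ` H \<noteq> {}"
      then obtain h where h: "h \<in> H" "g \<circ> h \<in> H" by blast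
      have "h permutes {1..n}" using H.mem_carrier[OF h(1)] by (simp add: sym_group_carrier)
      then have "(g \<circ> h) \<circ> inv' h = g" by (simp add: comp_assoc permutes_inv_o)
      then show False using comp[OF h(2) invH[OF h(1)]] gH by simp
    qed
    have inj: "inj_on (\<lambda>h. g \<circ> h) H"
      by (intro inj_onI) (metis comp_assoc id_comp permutes_inv_o(2)[OF g])
    have sub: "H \<union> (\<lambda>h. g \<circ> h) ` H \<subseteq> carrier (sym_group n)"
      using H.subset g by (auto simp: sym_group_carrier intro!: permutes_compose)
    have finH: "finite H" using fin H.subset finite_subset by blast
    then have "card (H \<union> (\<lambda>h. g \<circ> h) ` H) = card (carrier (sym_group n))"
      using card disj by (subst card_Un_disjoint) (auto simp: card_image[OF inj] sym_group_card_carrier)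
    then have "H \<union> (\<lambda>h. g \<circ> h) ` H = carrier (sym_group n)"
      using sub fin by (intro card_subset_eq)
    moreover have "g \<circ> g \<in> carrier (sym_group n)"
      using g by (simp add: sym_group_carrier permutes_compose)
    ultimately obtain h where h: "h \<in> H" "g \<circ> g = g \<circ> h" using gg by auto
    then have "g = h" by (metis comp_assoc id_comp permutes_inv_o(2)[OF g])
    then show False using h(1) gH by simp
  qed
  have "three_cycles n \<subseteq> H"
  proof
    fix c assume c: "c \<in> three_cycles n"
    then have "c \<in> carrier (alt_group n)" using three_cycles_incl by blast
    then have "c permutes {1..n}" by (simp add: alt_group_carrier)
    then have "(c \<circ> c) \<circ> (c \<circ> c) \<in> H" by (intro square permutes_compose)
    \<comment> \<open>As \<open>c\<close> has order dividing 3, its fourth power is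
      \<open>c\<close>.\<close>
    also have "(c \<circ> c) \<circ> (c \<circ> c) = c"
      using three_cycle_cube[OF c] by (metis comp_assoc comp_id)
    finally show "c \<in> H" .
  qed
  have "carrier (alt_group n) \<subseteq> H"
  proof
    fix p assume "p \<in> carrier (alt_group n)"
    then have "p \<in> generate (alt_group n) (three_cycles n)"
      using alt_group_carrier_as_three_cycles by blast
    then show "p \<in> H"
    proof induction
      case one then show ?case using H.one_closed by (simp add: alt_group_one sym_group_one id_def)
    next
      case (incl h) then show ?case using \<open>three_cycles n \<subseteq> H\<close> by blast
    next
      case (inv h)
      then have "h \<in> H" "h \<in> carrier (alt_group n)"
        using \<open>three_cycles n \<subseteq> H\<close> three_cycles_incl by blast+
      then show ?case using invH[of h] alt_group_inv_equality[of h n] by simp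
    next
      case (eng h1 h2) then show ?case using comp[of h1 h2] by (simp only: alt_group_mult)
    qed
  qed
  moreover have "card (carrier (alt_group n)) = card H"
    using alt_group_card_carrier[OF n] card by simp
  moreover have "finite H" using fin H.subset finite_subset by blast
  ultimately show ?thesis using card_subset_eq by metis
qed

section \<open>Discriminant and resolvent of the quartic\<close>

lemma squarefree_mult_eq_squareD:
  fixes x y z :: int
  assumes "squarefree x" "squarefree y" "x * y = z\<^sup>2"
  shows "x = y"
proof -
  have "x \<noteq> 0" using assms(1) by auto
  have "x dvd z" using squarefree_dvd_powerD[OF assms(1), of z 2] assms(3) by (metis dvd_triv_left)
  then obtain w where w: "z = x * w" by blast
  then have "x * y = x * (x * w\<^sup>2)" using assms(3) by (simp add: power2_eq_square mult_ac)
  then have y: "y = x * w\<^sup>2" using \<open>x \<noteq> 0\<close> by simp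
  then have "w dvd 1" using squarefreeD[OF assms(2), of w] by simp
  then have "w\<^sup>2 = 1" by (metis power2_eq_1_iff zdvd1_eq abs_eq_iff' abs_1 power2_abs)
  then show ?thesis using y by simp
qed

lemma I4: "{1..4} = {1, 2, 3, 4 :: nat}" by auto

lemma sum4: "(\<Sum>i\<in>{1..4}. g i) = g 1 + g 2 + g 3 + (g 4 :: 'a :: comm_monoid_add)"
  and prod4: "(\<Prod>i\<in>{1..4}. h i) = h 1 * h 2 * h 3 * (h 4 :: 'b :: comm_monoid_mult)"
  for g h :: "nat \<Rightarrow> _"
  unfolding I4 by (simp_all add: ac_simps)

text \<open>The roots are listed with multiplicity; that they are distinct follows from the nonzero
  discriminant.\<close>

locale quartic_roots =
  fixes b :: int and \<theta> :: "nat \<Rightarrow> complex"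
  assumes sqf: "squarefree b" "squarefree (256 - 27 * b)"
    and factors: "map_poly of_int (quartic b b) = (\<Prod>i\<in>{1..4}. [:- \<theta> i, 1:])"
begin

lemma vieta:
  "\<theta> 1 + \<theta> 2 + \<theta> 3 + \<theta> 4 = 0"
  "\<theta> 1 * \<theta> 2 + \<theta> 1 * \<theta> 3 + \<theta> 1 * \<theta> 4 + \<theta> 2 * \<theta> 3 + \<theta> 2 * \<theta> 4 + \<theta> 3 * \<theta> 4 = 0"
  "\<theta> 1 * \<theta> 2 * \<theta> 3 + \<theta> 1 * \<theta> 2 * \<theta> 4 + \<theta> 1 * \<theta> 3 * \<theta> 4 + \<theta> 2 * \<theta> 3 * \<theta> 4 = - of_int b"
  "\<theta> 1 * \<theta> 2 * \<theta> 3 * \<theta> 4 = of_int b"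
proof -
  have eq: "[:of_int b, of_int b, 0, 0, 1:] =
      [:- \<theta> 1, 1:] * ([:- \<theta> 2, 1:] * ([:- \<theta> 3, 1:] * [:- \<theta> 4, 1:]))"
    using factors unfolding prod4 by (simp only: quartic_def map_poly_pCons map_poly_1 map_poly_0 of_int_0 of_int_1 mult.assoc)
  show "\<theta> 1 + \<theta> 2 + \<theta> 3 + \<theta> 4 = 0"
    using arg_cong[OF eq, of "\<lambda>p. coeff p 3"] by (simp add: numeral_eq_Suc algebra_simps add_eq_0_iff)
  show "\<theta> 1 * \<theta> 2 + \<theta> 1 * \<theta> 3 + \<theta> 1 * \<theta> 4 + \<theta> 2 * \<theta> 3 + \<theta> 2 * \<theta> 4 + \<theta> 3 * \<theta> 4 = 0"
    using arg_cong[OF eq, of "\<lambda>p. coeff p 2"] by (simp add: numeral_eq_Suc algebra_simps)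
  show "\<theta> 1 * \<theta> 2 * \<theta> 3 + \<theta> 1 * \<theta> 2 * \<theta> 4 + \<theta> 1 * \<theta> 3 * \<theta> 4 + \<theta> 2 * \<theta> 3 * \<theta> 4 = - of_int b"
    using arg_cong[OF eq, of "\<lambda>p. coeff p 1"] by (simp add: algebra_simps eq_neg_iff_add_eq_0)
  show "\<theta> 1 * \<theta> 2 * \<theta> 3 * \<theta> 4 = of_int b"
    using arg_cong[OF eq, of "\<lambda>p. coeff p 0"] by (simp add: algebra_simps)
qed

lemma quartic_factors: "x ^ 4 + of_int b * x + of_int b = (x - \<theta> 1) * (x - \<theta> 2) * (x - \<theta> 3) * (x - \<theta> 4)"
  using arg_cong[OF factors[unfolded I4], of "\<lambda>p. poly p x"]
  by (simp add: quartic_def map_poly_pCons poly_prod power4_eq_xxxx algebra_simps)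

lemma root_eq: "i \<in> {1..4} \<Longrightarrow> \<theta> i ^ 4 = - of_int b * \<theta> i - of_int b"
  using quartic_factors[of "\<theta> i"] unfolding I4 by (auto simp: add_eq_0_iff2 algebra_simps)

text \<open>Vieta settles exponents up to 3; from 4 on, the equation of the roots lowers the
  exponent.\<close>

sublocale rational_power_sums 4 \<theta>
proof
  fix e show "(\<Sum>i\<in>{1..4}. \<theta> i ^ e) \<in> \<rat>"
  proof (induction e rule: less_induct)
    case (less e)
    consider "e = 0" | "e = 1" | "e = 2" | "e = 3" | k where "e = k + 4"
      by atomize_elim presburger
    then show ?case
    proof cases
      case 2
      then show ?thesis using vieta(1) unfolding sum4 by simp
    next
      case 3
      have "\<theta> 1 ^ 2 + \<theta> 2 ^ 2 + \<theta> 3 ^ 2 + \<theta> 4 ^ 2 = 0" using vieta(1,2) by Groebner_Basis.algebra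
      then show ?thesis unfolding sum4 3 by simp
    next
      case 4
      have "\<theta> 1 ^ 3 + \<theta> 2 ^ 3 + \<theta> 3 ^ 3 + \<theta> 4 ^ 3 =
        3 * (\<theta> 1 * \<theta> 2 * \<theta> 3 + \<theta> 1 * \<theta> 2 * \<theta> 4 + \<theta> 1 * \<theta> 3 * \<theta> 4 + \<theta> 2 * \<theta> 3 * \<theta> 4)"
        using vieta(1,2) by Groebner_Basis.algebra
      then show ?thesis unfolding vieta(3) unfolding sum4 4 by simp
    next
      case 5
      have "(\<Sum>i\<in>{1..4}. \<theta> i ^ e) = (\<Sum>i\<in>{1..4}. \<theta> i ^ k * \<theta> i ^ 4)" by (simp add: 5 power_add)
      also have "\<dots> = (\<Sum>i\<in>{1..4}. - of_int b * \<theta> i ^ (k + 1) - of_int b * \<theta> i ^ k)"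
        by (intro sum.cong refl, subst root_eq) (auto simp: algebra_simps)
      also have "\<dots> = - of_int b * (\<Sum>i\<in>{1..4}. \<theta> i ^ (k + 1)) - of_int b * (\<Sum>i\<in>{1..4}. \<theta> i ^ k)"
        by (simp only: sum_subtractf sum_distrib_left)
      also have "\<dots> \<in> \<rat>"
        using less.IH[of "k + 1"] less.IH[of k] 5
        by (intro Rats_diff Rats_mult Rats_minus_iff[THEN iffD2] Rats_of_int) simp_all
      finally show ?thesis .
    qed simp
  qed
qed

definition vandermonde :: "(nat \<Rightarrow> nat) \<Rightarrow> complex" where
  "vandermonde \<sigma> = (\<theta> (\<sigma> 1) - \<theta> (\<sigma> 2)) * (\<theta> (\<sigma> 1) - \<theta> (\<sigma> 3)) * (\<theta> (\<sigma> 1) - \<theta> (\<sigma> 4)) *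
     (\<theta> (\<sigma> 2) - \<theta> (\<sigma> 3)) * (\<theta> (\<sigma> 2) - \<theta> (\<sigma> 4)) * (\<theta> (\<sigma> 3) - \<theta> (\<sigma> 4))"

lemma vandermonde_root_function: "vandermonde \<in> root_functions 4 \<theta>"
  unfolding vandermonde_def
  by (intro root_functions_mult root_functions_diff root_functions_root) auto

lemma vandermonde_comp:
  assumes "p permutes {1..4}"
  shows "vandermonde (\<sigma> \<circ> p) = of_int (sign p) * vandermonde \<sigma>"
  using assms finite_atLeastAtMost
proof (induction arbitrary: \<sigma> rule: permutes_induct)
  case id then show ?case by simp
next
  case (swap a c p)
  define W where "W x y z w = (x - y) * (x - z) * (x - w) * (y - z) * (y - w) * (z - w)"
    for x y z w :: complex
  have W: "W y x z w = - W x y z w" "W x z y w = - W x y z w" "W x y w z = - W x y z w" for x y z w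
    unfolding W_def by Groebner_Basis.algebra+
  have V: "vandermonde \<sigma> = W (\<theta> (\<sigma> 1)) (\<theta> (\<sigma> 2)) (\<theta> (\<sigma> 3)) (\<theta> (\<sigma> 4))" for \<sigma>
    by (simp add: vandermonde_def W_def)
  \<comment> \<open>The remaining transpositions are products of an odd number of adjacent
    ones.\<close>
  have W': "W z y x w = - W x y z w" "W w y z x = - W x y z w" "W x w z y = - W x y z w" for x y z w
    using W by metis+
  have t: "vandermonde (\<sigma> \<circ> Transposition.transpose a c) = - vandermonde \<sigma>"
    using swap.hyps(1-3) unfolding I4 V
    by (elim insertE emptyE; simp add: Transposition.transpose_def) (rule W W')+
  have "sign (Transposition.transpose a c \<circ> p) = - sign p"
    using swap.hyps by (subst sign_compose)
      (auto simp: sign_swap_id permutation_swap_id intro: permutes_imp_permutation[of "{1..4}"])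
  moreover have "\<sigma> \<circ> (Transposition.transpose a c \<circ> p) = (\<sigma> \<circ> Transposition.transpose a c) \<circ> p" by (simp add: comp_assoc)
  ultimately show ?case using swap.IH[of "\<sigma> \<circ> Transposition.transpose a c"] t by (simp del: comp_apply)
qed

text \<open>
  The discriminant is \<open>\<Prod>\<^sub>i f' (\<theta>\<^sub>i)\<close>, where \<open>\<theta> f' (\<theta>) = 4 \<theta>\<^sup>4 + b \<theta> = - b (3 \<theta> + 4)\<close> for every
  root \<open>\<theta>\<close>, and \<open>\<Prod>\<^sub>i (3 \<theta>\<^sub>i + 4) = 81 f (- 4/3)\<close>.
\<close>

lemma vandermonde_square: "(vandermonde id)\<^sup>2 = of_int (b ^ 3 * (256 - 27 * b))"
proof -
  define B :: complex where "B = of_int b"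
  have "b \<noteq> 0" using sqf by auto
  then have "B \<noteq> 0" by (simp add: B_def)
  obtain x y z w where xyzw: "x = \<theta> 1" "y = \<theta> 2" "z = \<theta> 3" "w = \<theta> 4" by blast
  note v = vieta[folded xyzw B_def]
  have d: "(x - y) * (x - z) * (x - w) = 4 * x ^ 3 + B" "(y - x) * (y - z) * (y - w) = 4 * y ^ 3 + B"
    "(z - x) * (z - y) * (z - w) = 4 * z ^ 3 + B" "(w - x) * (w - y) * (w - z) = 4 * w ^ 3 + B"
    using v(1-3) by Groebner_Basis.algebra+
  have r: "t * (4 * t ^ 3 + B) = - B * (3 * t + 4)" if "t \<in> {x, y, z, w}" for t
  proof -
    have t4: "t ^ 4 = - B * t - B" using that root_eq unfolding xyzw B_def by auto
    have "t * (4 * t ^ 3 + B) = 4 * t ^ 4 + B * t"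
      by (simp add: power4_eq_xxxx power3_eq_cube algebra_simps)
    also have "\<dots> = 4 * (- B * t - B) + B * t" by (simp only: t4)
    also have "\<dots> = - B * (3 * t + 4)" by (simp add: algebra_simps)
    finally show ?thesis .
  qed
  have V: "vandermonde id = (x - y) * (x - z) * (x - w) * (y - z) * (y - w) * (z - w)"
    by (simp add: vandermonde_def xyzw)
  have "B * (vandermonde id)\<^sup>2 = (x * y * z * w) * (vandermonde id)\<^sup>2" by (simp only: v(4))
  also have "\<dots> = (x * ((x - y) * (x - z) * (x - w))) * (y * ((y - x) * (y - z) * (y - w))) *
     (z * ((z - x) * (z - y) * (z - w))) * (w * ((w - x) * (w - y) * (w - z)))"
  proof -
    \<comment> \<open>Each difference is used once in either orientation; the six sign changes
      cancel.\<close>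
    have "(x * y * z * w) * (d1 * d2 * d3 * d4 * d5 * d6)\<^sup>2 =
      (x * (d1 * d2 * d3)) * (y * (- d1 * d4 * d5)) * (z * (- d2 * - d4 * d6)) * (w * (- d3 * - d5 * - d6))"
      for d1 d2 d3 d4 d5 d6 by (simp add: power2_eq_square mult_ac)
    from this[of "x - y" "x - z" "x - w" "y - z" "y - w" "z - w"] show ?thesis
      unfolding V minus_diff_eq .
  qed
  also have "\<dots> = B ^ 4 * ((3 * x + 4) * (3 * y + 4) * (3 * z + 4) * (3 * w + 4))"
    unfolding d by (simp add: r power4_eq_xxxx mult_ac)
  also have "(3 * x + 4) * (3 * y + 4) * (3 * z + 4) * (3 * w + 4) = 256 - 27 * B"
    using v by Groebner_Basis.algebra
  also have "B ^ 4 * (256 - 27 * B) = B * (B ^ 3 * (256 - 27 * B))"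
    by (simp add: power4_eq_xxxx power3_eq_cube)
  finally have "(vandermonde id)\<^sup>2 = B ^ 3 * (256 - 27 * B)"
    using \<open>B \<noteq> 0\<close> by (simp only: mult_cancel_left simp_thms)
  then show ?thesis
    by (simp only: B_def of_int_mult of_int_power of_int_diff of_int_numeral)
qed

text \<open>Two square-free integers whose product is a square coincide, but 28 b = 256 has no
  integer solution.\<close>

lemma discriminant_not_square: "y\<^sup>2 \<noteq> rat_of_int (b ^ 3 * (256 - 27 * b))"
proof
  define m where "m = b ^ 3 * (256 - 27 * b)"
  assume y: "y\<^sup>2 = rat_of_int (b ^ 3 * (256 - 27 * b))"
  then have "poly (map_poly of_int [:- m, 0, 1:]) y = 0"
    by (simp add: map_poly_pCons power2_eq_square m_def)
  then obtain z :: int where "y = of_int z" by (rule rat_root_monic_int_is_int) simp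
  then have "of_int (z\<^sup>2) = rat_of_int m" using y by (simp add: m_def)
  then have z: "z\<^sup>2 = b ^ 3 * (256 - 27 * b)" unfolding of_int_eq_iff m_def .
  have "b dvd z\<^sup>2" unfolding z by (simp add: power3_eq_cube)
  then have "b dvd z" using squarefree_dvd_powerD[OF sqf(1)] by blast
  then obtain k where k: "z = b * k" by blast
  have "b \<noteq> 0" using sqf by auto
  have "b\<^sup>2 * k\<^sup>2 = b\<^sup>2 * (b * (256 - 27 * b))"
    using z unfolding k by (simp add: power2_eq_square power3_eq_cube mult_ac)
  then have "b * (256 - 27 * b) = k\<^sup>2" using \<open>b \<noteq> 0\<close> by simp
  then have "b = 256 - 27 * b" by (rule squarefree_mult_eq_squareD[OF sqf])
  then show False by presburger
qed

lemma vandermonde_nonzero: "vandermonde id \<noteq> 0"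
proof
  assume "vandermonde id = 0"
  then have "of_int (b ^ 3 * (256 - 27 * b)) = (0 :: complex)"
    unfolding vandermonde_square[symmetric] by simp
  then have "b ^ 3 * (256 - 27 * b) = 0" unfolding of_int_eq_0_iff .
  then have "b = 0 \<or> 256 - 27 * b = 0" by simp
  then show False using sqf not_squarefree_0 by metis
qed

lemma roots_inj: "inj_on \<theta> {1..4}"
  using vandermonde_nonzero unfolding I4 by (auto simp: vandermonde_def)

text \<open>X^2 minus the discriminant is irreducible, so the negative of the Vandermonde product is
  a conjugate of it, and only an odd permutation changes its sign.\<close>

lemma odd_galois_perm: "\<exists>\<tau>\<in>galois_perms. \<not> evenperm \<tau>"
proof -
  obtain m where m: "m = b ^ 3 * (256 - 27 * b)" by blast
  define q where "q = [:- rat_of_int m, 0, 1:]"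
  have "Factorial_Ring.irreducible q"
    using discriminant_not_square[folded m]
    by (intro irreducible_if_no_root) (auto simp: q_def power2_eq_square)
  have q: "poly (map_poly of_rat q) x = x\<^sup>2 - (vandermonde id)\<^sup>2" for x
    unfolding vandermonde_square[folded m] by (simp add: q_def map_poly_pCons power2_eq_square of_rat_minus)
  have "- vandermonde id \<in> vandermonde ` galois_perms"
    by (subst galois_perms_conjugates[OF \<open>Factorial_Ring.irreducible q\<close> vandermonde_root_function])
      (simp_all add: q)
  then obtain \<tau> where \<tau>: "\<tau> \<in> galois_perms" "vandermonde \<tau> = - vandermonde id" by auto
  have "\<not> evenperm \<tau>"
  proof
    assume "evenperm \<tau>"
    then have "vandermonde \<tau> = vandermonde id"
      using vandermonde_comp[of \<tau> id] \<tau>(1) by (simp add: galois_perms_def sign_def)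
    then show False using \<tau>(2) vandermonde_nonzero by simp
  qed
  then show ?thesis using \<tau>(1) by blast
qed

lemma roots_eq: "{x. poly (map_poly of_rat (map_poly rat_of_int (quartic b b))) x = 0} = \<theta> ` {1..4}"
proof -
  have "poly (map_poly of_rat (map_poly rat_of_int (quartic b b))) x =
      (x - \<theta> 1) * (x - \<theta> 2) * (x - \<theta> 3) * (x - \<theta> 4)" for x
    unfolding quartic_factors[symmetric]
    by (simp add: quartic_def map_poly_pCons power4_eq_xxxx algebra_simps)
  then show ?thesis unfolding I4 by auto
qed

lemma four_dvd_card: "4 dvd card galois_perms"
proof -
  define F where "F \<sigma> = \<theta> (\<sigma> 1)" for \<sigma> :: "nat \<Rightarrow> nat"
  have F: "F \<in> root_functions 4 \<theta>" unfolding F_def by (rule root_functions_root) simp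
  have "F ` galois_perms = \<theta> ` {1..4}"
    unfolding roots_eq[symmetric] using roots_eq
    by (intro galois_perms_conjugates quartic_irreducible sqf F) (auto simp: F_def)
  then have "card (F ` galois_perms) = 4" using card_image[OF roots_inj] by simp
  then show ?thesis using card_image_galois_perms_dvd[OF F] by simp
qed

lemma three_dvd_card:
  assumes "b \<noteq> 3" "b \<noteq> 5"
  shows "3 dvd card galois_perms"
proof -
  define F where "F \<sigma> = \<theta> (\<sigma> 1) * \<theta> (\<sigma> 2) + \<theta> (\<sigma> 3) * \<theta> (\<sigma> 4)" for \<sigma> :: "nat \<Rightarrow> nat"
  have F: "F \<in> root_functions 4 \<theta>"
    unfolding F_def by (intro root_functions.add root_functions_mult root_functions_root) auto
  define q where "q = [:- (rat_of_int b)\<^sup>2, - 4 * rat_of_int b, 0, 1:]"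
  have irr: "Factorial_Ring.irreducible q"
  proof (rule irreducible_if_no_root)
    fix x show "poly q x \<noteq> 0"
      using resolvent_rat_root[OF sqf(1), of x] assms
      by (auto simp: q_def power2_eq_square power3_eq_cube algebra_simps)
  qed (simp add: q_def)
  have q: "poly (map_poly of_rat q) y = y ^ 3 - 4 * of_int b * y - (of_int b)\<^sup>2" for y :: complex
    by (simp add: q_def map_poly_pCons power2_eq_square power3_eq_cube of_rat_mult of_rat_minus algebra_simps)
  have res: "poly (map_poly of_rat q) (x * y + z * w) = 0"
    if "x + y + z + w = 0" "x * y + x * z + x * w + y * z + y * w + z * w = 0"
      "x * y * z + x * y * w + x * z * w + y * z * w = - of_int b" "x * y * z * w = of_int b"
    for x y z w :: complex
  proof -
    have "(x * y + z * w) ^ 3 - 4 * (x * y * z * w) * (x * y + z * w) -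
        (x * y * z + x * y * w + x * z * w + y * z * w)\<^sup>2 = 0"
    proof -
      have w: "w = - x - y - z" using that(1) by Groebner_Basis.algebra
      \<comment> \<open>With z + w = - (x + y), the vanishing second symmetric function gives this,
        and the third becomes (x + y)(z w - x y); squaring it eliminates x + y.\<close>
      have F: "(x + y)\<^sup>2 = x * y + z * w"
        using that(1,2) by Groebner_Basis.algebra
      have e3: "x * y * z + x * y * w + x * z * w + y * z * w = (x + y) * (z * w - x * y)"
        unfolding w by (simp add: algebra_simps)
      have "(x * y + z * w) ^ 3 - 4 * (x * y * z * w) * (x * y + z * w) =
          (x * y + z * w) * (z * w - x * y)\<^sup>2"
        by (simp add: power2_eq_square power3_eq_cube algebra_simps)
      then show ?thesis unfolding e3 power_mult_distrib F by simp
    qed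
    then show ?thesis unfolding that(3,4) q by simp
  qed
  define R where "R = {\<theta> 1 * \<theta> 2 + \<theta> 3 * \<theta> 4, \<theta> 1 * \<theta> 3 + \<theta> 2 * \<theta> 4, \<theta> 1 * \<theta> 4 + \<theta> 2 * \<theta> 3}"
  \<comment> \<open>Differences of resolvent roots are products of differences of the \<theta> i, so
    the three values are distinct.\<close>
  have d: "\<theta> 1 * \<theta> 2 + \<theta> 3 * \<theta> 4 - (\<theta> 1 * \<theta> 3 + \<theta> 2 * \<theta> 4) = (\<theta> 1 - \<theta> 4) * (\<theta> 2 - \<theta> 3)"
    "\<theta> 1 * \<theta> 2 + \<theta> 3 * \<theta> 4 - (\<theta> 1 * \<theta> 4 + \<theta> 2 * \<theta> 3) = (\<theta> 1 - \<theta> 3) * (\<theta> 2 - \<theta> 4)"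
    "\<theta> 1 * \<theta> 3 + \<theta> 2 * \<theta> 4 - (\<theta> 1 * \<theta> 4 + \<theta> 2 * \<theta> 3) = (\<theta> 1 - \<theta> 2) * (\<theta> 3 - \<theta> 4)"
    by Groebner_Basis.algebra+
  have "card R = 3"
    using vandermonde_nonzero d unfolding R_def
    by (auto simp: vandermonde_def card_insert_if)
  moreover have "R \<subseteq> {y. poly (map_poly of_rat q) y = 0}"
    unfolding R_def using vieta by (auto intro!: res simp: algebra_simps)
  moreover have q0: "map_poly of_rat q \<noteq> (0 :: complex poly)" by (simp add: q_def map_poly_pCons)
  moreover have "card {y :: complex. poly (map_poly of_rat q) y = 0} \<le> 3"
    using card_poly_roots_bound[OF q0] by (simp add: q_def map_poly_pCons)
  moreover have "finite {y :: complex. poly (map_poly of_rat q) y = 0}"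
    using q0 by (rule poly_roots_finite)
  ultimately have "card {y :: complex. poly (map_poly of_rat q) y = 0} = 3"
    by (metis card_mono le_antisym)
  moreover have "F ` galois_perms = {y. poly (map_poly of_rat q) y = 0}"
    using vieta by (intro galois_perms_conjugates irr F) (auto simp: F_def intro!: res)
  ultimately show ?thesis using card_image_galois_perms_dvd[OF F] by simp
qed

lemma galois_perms_eq_all:
  assumes "b \<noteq> 3" "b \<noteq> 5"
  shows "galois_perms = {\<sigma>. \<sigma> permutes {1..4}}"
proof -
  interpret S: group "sym_group 4" by (rule sym_group_is_group)
  have car: "carrier (sym_group 4) = {\<sigma>. \<sigma> permutes {1..4}}" by (auto simp: sym_group_carrier)
  have card24: "card (carrier (sym_group 4)) = 24" by (simp add: sym_group_card_carrier fact_numeral)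
  have fin: "finite (carrier (sym_group 4))" by (rule card_ge_0_finite) (simp add: card24)
  have "card galois_perms dvd Coset.order (sym_group 4)"
    using S.lagrange[OF subgroup_galois_perms] dvd_triv_right by metis
  then have "card galois_perms dvd 24" by (simp only: Coset.order_def card24)
  moreover have "12 dvd card galois_perms"
    using four_dvd_card three_dvd_card[OF assms] by presburger
  ultimately have "card galois_perms = 12 \<or> card galois_perms = 24"
  proof (elim dvdE)
    fix k l assume k: "card galois_perms = 12 * k" and "24 = card galois_perms * l"
    then have "k * l = 2" by simp
    then have "k dvd 2" "k \<noteq> 0" by (metis dvd_triv_left, metis mult_0 zero_neq_numeral)
    then have "k = 1 \<or> k = 2" using dvd_imp_le[of k 2] by linarith
    then show ?thesis using k by auto
  qed
  moreover have "card galois_perms \<noteq> 12"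
  proof
    assume "card galois_perms = 12"
    then have "galois_perms = carrier (alt_group 4)"
      by (intro half_subgroup_eq_alt_group subgroup_galois_perms) (simp_all add: fact_numeral)
    then show False using odd_galois_perm by (auto simp: alt_group_carrier)
  qed
  ultimately have "card galois_perms = card (carrier (sym_group 4))" using card24 by simp
  then have "galois_perms = carrier (sym_group 4)"
    using fin subgroup.subset[OF subgroup_galois_perms] by (intro card_subset_eq)
  then show ?thesis unfolding car .
qed

end

lemma quartic_roots_exist:
  assumes "squarefree b" "squarefree (256 - 27 * b)"
  obtains \<theta> where "quartic_roots b \<theta>"
proof -
  define p where "p = (map_poly of_int (quartic b b) :: complex poly)"
  have p: "p = [:of_int b, of_int b, 0, 0, 1:]" by (simp add: p_def quartic_def map_poly_pCons)
  then obtain A where A: "size A = degree p" "p = smult (lead_coeff p) (\<Prod>x\<in>#A. [:-x, 1:])"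
    using alg_closed_imp_factorization[of p] by auto
  obtain xs where xs: "mset xs = A" using ex_mset by blast
  then have "length xs = 4" using A(1) p by auto
  then obtain x1 x2 x3 x4 where x: "xs = [x1, x2, x3, x4]"
    by (auto simp: length_Suc_conv numeral_eq_Suc)
  define \<theta> where "\<theta> i = xs ! (i - 1)" for i
  have "p = (\<Prod>x\<in>#mset xs. [:- x, 1:])"
    using A(2) p xs by simp
  also have "\<dots> = (\<Prod>i\<in>{1..4}. [:- \<theta> i, 1:])"
    unfolding x prod4 by (simp only: mset.simps image_mset_add_mset prod_mset.add_mset
      image_mset_empty prod_mset_empty) (simp add: \<theta>_def x numeral_eq_Suc algebra_simps)
  finally have "p = (\<Prod>i\<in>{1..4}. [:- \<theta> i, 1:])" .
  then show ?thesis using that assms unfolding p_def by (simp only: quartic_roots_def)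
qed

theorem number_field_galois_group_quartic:
  assumes "squarefree b" "squarefree (256 - 27 * b)" "b \<noteq> 3" "b \<noteq> 5"
    and "poly (map_poly of_int (quartic b b)) \<theta> = 0"
  shows "number_field_galois_group (rat_adjoin \<theta>) \<cong> sym_group 4"
proof -
  obtain t where "quartic_roots b t" using quartic_roots_exist[OF assms(1,2)] .
  then interpret quartic_roots b t .
  have "poly (map_poly of_rat (map_poly rat_of_int (quartic b b))) \<theta> = 0"
    using assms(5) by (simp add: quartic_def map_poly_pCons)
  then obtain i where i: "i \<in> {1..4}" "\<theta> = t i" using roots_eq by blast
  have "galois_closure (rat_adjoin \<theta>) = splitting_field"
    unfolding i(2) by (rule galois_closure_rat_adjoin[OF quartic_irreducible[OF assms(1)] roots_eq i(1)])
  then show ?thesis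
    using rat_automorphism_group_iso_sym_group[OF roots_inj galois_perms_eq_all[OF assms(3,4)]]
    by (simp add: number_field_galois_group_def)
qed

section \<open>Counting multiples of squares in an interval\<close>

text \<open>Members of one residue class have distinct quotients by \<open>m\<close>. The summand 2
  accounts for the floor at the lower end and for counting both ends.\<close>

lemma card_congruent_le:
  fixes S :: "int set" and m :: int
  assumes m: "m > 0" and S: "S \<subseteq> {- int N..int N}" and cong: "\<And>x y. x \<in> S \<Longrightarrow> y \<in> S \<Longrightarrow> m dvd x - y"
  shows "real (card S) \<le> 2 * real N / of_int m + 2"
proof -
  have inj: "inj_on (\<lambda>x. x div m) S"
  proof (rule inj_onI)
    fix x y assume xy: "x \<in> S" "y \<in> S" "x div m = y div m"
    have "x mod m = y mod m" using cong[OF xy(1,2)] by (simp add: mod_eq_dvd_iff)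
    then show "x = y" using xy(3) by (metis div_mult_mod_eq)
  qed
  define l u where "l = (- int N) div m" and "u = int N div m"
  have "(\<lambda>x. x div m) ` S \<subseteq> {l..u}"
    using S m by (auto simp: l_def u_def intro!: zdiv_mono1)
  then have "card S \<le> card {l..u}"
    using inj by (metis card_image card_mono finite_atLeastAtMost_int)
  moreover have lu: "l \<le> u" unfolding l_def u_def using m by (intro zdiv_mono1) auto
  ultimately have "real (card S) \<le> of_int (u - l + 1)" by simp
  moreover have "of_int u \<le> real N / of_int m"
    unfolding u_def using real_of_int_div4[of "int N" m] by simp
  moreover have "of_int l \<ge> - real N / of_int m - 1"
  proof -
    have "l = \<lfloor>real_of_int (- int N) / of_int m\<rfloor>" unfolding l_def by (rule floor_divide_of_int_eq[symmetric])
    then show ?thesis by linarith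
  qed
  moreover have "2 * real N / of_int m = 2 * (real N / of_int m)" "- real N / of_int m = - (real N / of_int m)"
    by simp_all
  ultimately show ?thesis by linarith
qed

definition square_divides :: "int \<Rightarrow> nat \<Rightarrow> bool" where
  "square_divides b k \<longleftrightarrow> (int k)\<^sup>2 dvd b \<or> (int k)\<^sup>2 dvd 256 - 27 * b"

lemma card_dvd_le:
  assumes "m > 0"
  shows "real (card {b \<in> {- int N..int N}. int m dvd b}) \<le> 2 * real N / m + 2"
proof -
  have "real (card {b \<in> {- int N..int N}. int m dvd b}) \<le> 2 * real N / of_int (int m) + 2"
    using assms by (intro card_congruent_le) auto
  then show ?thesis by simp
qed

lemma card_square_divides_le:
  assumes "k > 0"
  shows "real (card {b \<in> {- int N..int N}. square_divides b k}) \<le> 4 * real N / (real k)\<^sup>2 + 4"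
proof -
  let ?S = "{b \<in> {- int N..int N}. (int k)\<^sup>2 dvd b}"
  let ?T = "{b \<in> {- int N..int N}. (int k)\<^sup>2 dvd 256 - 27 * b}"
  have S: "real (card ?S) \<le> 2 * real N / of_int ((int k)\<^sup>2) + 2"
    using assms by (intro card_congruent_le) auto
  have T: "real (card ?T) \<le> 2 * real N / of_int ((int k)\<^sup>2) + 2"
  proof (rule card_congruent_le)
    fix x y assume xy: "x \<in> ?T" "y \<in> ?T"
    then have "(int k)\<^sup>2 dvd 256 - 27 * x" "(int k)\<^sup>2 dvd 256 - 27 * y" by blast+
    then have "(int k)\<^sup>2 dvd (256 - 27 * y) - (256 - 27 * x)" by (rule dvd_diff[rotated])
    then have *: "(int k)\<^sup>2 dvd 3 ^ 3 * (x - y)" by (simp add: algebra_simps)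
    \<comment> \<open>9 does not divide 256, so a solution can exist only for \<open>k\<close> prime
      to 3; then 27 is invertible modulo \<open>k^2\<close> and all solutions lie in one
      class.\<close>
    have "\<not> 3 dvd int k"
    proof
      assume "3 dvd int k"
      then have "3\<^sup>2 dvd (int k)\<^sup>2" by (rule dvd_power_same)
      then have "3\<^sup>2 dvd 256 - 27 * x" using xy(1) dvd_trans by blast
      then show False by simp presburger
    qed
    then have "coprime 3 (int k)" by (intro prime_imp_coprime) auto
    then have c: "coprime ((int k)\<^sup>2) (3 ^ 3)"
      unfolding coprime_power_left_iff coprime_power_right_iff by (simp add: coprime_commute)
    show "(int k)\<^sup>2 dvd x - y" using coprime_dvd_mult_right_iff[OF c] * by blast
  qed (use assms in auto)
  have eq: "{b \<in> {- int N..int N}. square_divides b k} = ?S \<union> ?T"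
    unfolding square_divides_def by blast
  have "card {b \<in> {- int N..int N}. square_divides b k} \<le> card ?S + card ?T"
    unfolding eq by (rule card_Un_le)
  then have "real (card {b \<in> {- int N..int N}. square_divides b k}) \<le> real (card ?S) + real (card ?T)"
    by linarith
  then show ?thesis using S T by simp
qed

text \<open>Limits the number of relevant \<open>k\<close> to O(sqrt N), so that the constant error
  per \<open>k\<close> is negligible against N.\<close>

lemma square_divides_bound:
  assumes "square_divides b k" "b \<noteq> 0" "\<bar>b\<bar> \<le> int N"
  shows "k \<le> nat \<lfloor>sqrt (256 + 27 * real N)\<rfloor>"
proof -
  have "(int k)\<^sup>2 \<le> 256 + 27 * int N"
    using assms(1) unfolding square_divides_def
  proof
    assume "(int k)\<^sup>2 dvd b"
    then have "\<bar>(int k)\<^sup>2\<bar> \<le> \<bar>b\<bar>" by (rule dvd_imp_le_int[OF assms(2)])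
    then show ?thesis using assms(3) by simp
  next
    assume d: "(int k)\<^sup>2 dvd 256 - 27 * b"
    have "256 - 27 * b \<noteq> 0" by presburger
    then have "\<bar>(int k)\<^sup>2\<bar> \<le> \<bar>256 - 27 * b\<bar>" by (rule dvd_imp_le_int[OF _ d])
    then show ?thesis using assms(3) by simp
  qed
  then have "real_of_int ((int k)\<^sup>2) \<le> real_of_int (256 + 27 * int N)" by (simp only: of_int_le_iff)
  then have "(real k)\<^sup>2 \<le> 256 + 27 * real N" by simp
  then have "real k \<le> sqrt (256 + 27 * real N)" by (rule real_le_rsqrt)
  then show ?thesis by (simp add: le_nat_floor)
qed

lemma card_some_square_divides_le:
  assumes "finite D" "0 \<notin> D"
  shows "real (card {b \<in> {- int N..int N}. \<exists>k\<in>D. square_divides b k})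
    \<le> (\<Sum>k\<in>D. 4 * real N / (real k)\<^sup>2 + 4)"
proof -
  have eq: "{b \<in> {- int N..int N}. \<exists>k\<in>D. square_divides b k} =
      (\<Union>k\<in>D. {b \<in> {- int N..int N}. square_divides b k})" by auto
  have "card {b \<in> {- int N..int N}. \<exists>k\<in>D. square_divides b k}
      \<le> (\<Sum>k\<in>D. card {b \<in> {- int N..int N}. square_divides b k})"
    unfolding eq by (rule card_UN_le[OF assms(1)])
  then have "real (card {b \<in> {- int N..int N}. \<exists>k\<in>D. square_divides b k})
      \<le> (\<Sum>k\<in>D. real (card {b \<in> {- int N..int N}. square_divides b k}))"
    by (simp only: of_nat_le_iff flip: of_nat_sum)
  also have "\<dots> \<le> (\<Sum>k\<in>D. 4 * real N / (real k)\<^sup>2 + 4)"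
    using assms(2) by (intro sum_mono card_square_divides_le) (metis gr0I)
  finally show ?thesis .
qed

lemma sum_inverse_squares_tail:
  assumes "z > 0"
  shows "(\<Sum>k\<in>{z<..K}. 1 / (real k)\<^sup>2) \<le> 1 / real z"
proof (cases "z \<le> K")
  case True
  then have "(\<Sum>k\<in>{z<..K}. 1 / (real k)\<^sup>2) \<le> 1 / real z - 1 / real K"
  proof (induction K rule: dec_induct)
    case (step K)
    have "{z<..Suc K} = insert (Suc K) {z<..K}" using step.hyps by auto
    moreover have "1 / (real (Suc K))\<^sup>2 \<le> 1 / real K - 1 / real (Suc K)"
    proof -
      have "1 / (real (Suc K))\<^sup>2 \<le> 1 / (real K * real (Suc K))"
        using assms step.hyps by (intro divide_left_mono) (auto simp: power2_eq_square mult_right_mono)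
      also have "\<dots> = 1 / real K - 1 / real (Suc K)"
        using assms step.hyps by (simp add: field_simps)
      finally show ?thesis .
    qed
    ultimately show ?case using step.IH by simp
  qed simp
  then show ?thesis by (smt (verit) of_nat_0_le_iff divide_nonneg_nonneg)
qed simp

text \<open>(2j + 1)^2 \<ge> 4 j (j + 1), so the sum telescopes; its start at j = 2, the odd number
  5, gives 1/8.\<close>

lemma sum_inverse_odd_squares: "(\<Sum>j\<in>{2..J}. 1 / (real (2 * j + 1))\<^sup>2) \<le> 1 / 8"
proof -
  have "(\<Sum>j\<in>{2..J}. 1 / (real (2 * j + 1))\<^sup>2) \<le> 1 / 8 - 1 / (4 * real (J + 1))" if "J \<ge> 1"
    using that
  proof (induction J rule: dec_induct)
    case (step J)
    have "{2..Suc J} = insert (Suc J) {2..J}" using step.hyps by auto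
    moreover have "1 / (real (2 * Suc J + 1))\<^sup>2 \<le> 1 / (4 * real (J + 1)) - 1 / (4 * real (Suc J + 1))"
    proof -
      have "1 / (real (2 * Suc J + 1))\<^sup>2 \<le> 1 / (4 * (real (J + 1) * real (Suc J + 1)))"
        by (intro frac_le) (auto simp: power2_eq_square algebra_simps intro!: add_pos_nonneg)
      also have "\<dots> = 1 / (4 * real (J + 1)) - 1 / (4 * real (Suc J + 1))"
      proof -
        have *: "1 / (4 * (x * y)) = 1 / (4 * x) - 1 / (4 * y)" if "y = x + 1" "x > 0" for x y :: real
          using that by (simp add: divide_simps)
        show ?thesis by (rule *) simp_all
      qed
      finally show ?thesis .
    qed
    ultimately show ?case using step.IH by simp
  qed simp
  then show ?thesis
    by (cases "J \<ge> 1") (smt (verit) of_nat_0_le_iff divide_nonneg_nonneg, simp)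
qed

section \<open>Density of periodic sets\<close>

lemma card_periodic_window:
  fixes P :: "int set"
  assumes M: "M > 0" and per: "\<And>x. x + int M \<in> P \<longleftrightarrow> x \<in> P"
  shows "card (P \<inter> {a..<a + int M}) = card (P \<inter> {0..<int M})"
proof -
  have step: "card (P \<inter> {a + 1..<a + 1 + int M}) = card (P \<inter> {a..<a + int M})" for a
  proof (cases "a \<in> P")
    case True
    then have "P \<inter> {a + 1..<a + 1 + int M} = insert (a + int M) (P \<inter> {a + 1..<a + int M})"
      "P \<inter> {a..<a + int M} = insert a (P \<inter> {a + 1..<a + int M})"
      using M per[of a] by auto
    then show ?thesis by simp
  next
    case False
    have "x \<in> P \<inter> {a + 1..<a + 1 + int M} \<longleftrightarrow> x \<in> P \<inter> {a..<a + int M}" for x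
      using M per[of a] False by (cases "x = a"; cases "x = a + int M") auto
    then have "P \<inter> {a + 1..<a + 1 + int M} = P \<inter> {a..<a + int M}" by blast
    then show ?thesis by simp
  qed
  show ?thesis
  proof (induction a rule: int_induct[where k = 0])
    case (step1 i) then show ?case using step[of i] by simp
  next
    case (step2 i) then show ?case using step[of "i - 1"] by simp
  qed simp
qed

lemma card_periodic_interval:
  fixes P :: "int set"
  assumes M: "M > 0" and per: "\<And>x. x + int M \<in> P \<longleftrightarrow> x \<in> P"
  defines "c \<equiv> card (P \<inter> {0..<int M})"
  shows "card (P \<inter> {a..<a + int (q * M)}) = q * c"
proof (induction q)
  case (Suc q)
  obtain t where t: "t = int (q * M)" by blast
  then have "t \<ge> 0" by simp
  have s: "int (Suc q * M) = t + int M" by (simp add: t)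
  have "P \<inter> {a..<a + (t + int M)} = P \<inter> {a..<a + t} \<union> P \<inter> {a + t..<a + t + int M}"
    using \<open>t \<ge> 0\<close> by auto
  moreover have "P \<inter> {a..<a + t} \<inter> (P \<inter> {a + t..<a + t + int M}) = {}" by auto
  ultimately have "card (P \<inter> {a..<a + (t + int M)}) = q * c + c"
    using Suc.IH[folded t] card_periodic_window[OF M per] by (simp add: card_Un_disjoint c_def)
  then show ?case unfolding s by simp
qed simp

lemma periodic_density:
  fixes P :: "int set"
  assumes M: "M > 0" and per: "\<And>x. x + int M \<in> P \<longleftrightarrow> x \<in> P"
  shows "(\<lambda>N. real (card (P \<inter> {- int N..int N})) / real (2 * N + 1))
    \<longlonglongrightarrow> real (card (P \<inter> {0..<int M})) / M"
proof -
  define c where "c = card (P \<inter> {0..<int M})"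
  have cM: "c \<le> M"
    unfolding c_def using card_mono[of "{0..<int M}" "P \<inter> {0..<int M}"] by simp
  \<comment> \<open>Full periods match the expected count exactly; the leftover of length r < M and
    its expected share both lie between 0 and r.\<close>
  have bound: "\<bar>real (card (P \<inter> {- int N..int N})) - real c / M * real (2 * N + 1)\<bar> \<le> M" for N
  proof -
    define q r where "q = (2 * N + 1) div M" and "r = (2 * N + 1) mod M"
    have qr: "2 * N + 1 = q * M + r" "r < M" unfolding q_def r_def using M by simp_all
    define a where "a = - int N"
    define U where "U = P \<inter> {a..<a + int (q * M)}"
    define W where "W = P \<inter> {a + int (q * M)..<a + int (q * M + r)}"
    have "{- int N..int N} = {a..<a + int (2 * N + 1)}" by (auto simp: a_def)
    moreover obtain t where t: "t = int (q * M)" by blast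
    then have "t \<ge> 0" by simp
    then have "{a..<a + (t + int r)} = {a..<a + t} \<union> {a + t..<a + (t + int r)}" by auto
    ultimately have "P \<inter> {- int N..int N} = U \<union> W"
      unfolding qr U_def W_def of_nat_add t by blast
    moreover have "U \<inter> W = {}" "finite U" "finite W" unfolding U_def W_def by auto
    ultimately have card: "card (P \<inter> {- int N..int N}) = q * c + card W"
      using card_periodic_interval[OF M per, of a q] by (simp add: card_Un_disjoint U_def c_def)
    have W: "card W \<le> r"
    proof -
      have "card W \<le> card {a + int (q * M)..<a + int (q * M + r)}"
        unfolding W_def by (intro card_mono) auto
      then show ?thesis by simp
    qed
    have e: "real c / M * real (2 * N + 1) = real q * c + real c / M * r"
      using M unfolding qr(1) by (simp add: distrib_left)
    have "0 \<le> real c / M * r" by simp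
    moreover have "real c / M * r \<le> r"
      by (rule mult_left_le_one_le) (use cM M in simp_all)
    moreover have "real (card W) \<le> real r" "real r < real M" using W qr(2) by simp_all
    ultimately show ?thesis unfolding e unfolding card of_nat_add of_nat_mult by linarith
  qed
  have "(\<lambda>N. real (card (P \<inter> {- int N..int N})) / real (2 * N + 1) - real c / M) \<longlonglongrightarrow> 0"
  proof (rule Lim_null_comparison)
    show "(\<lambda>N. real M / real (2 * N + 1)) \<longlonglongrightarrow> 0" by real_asymp
    have "\<bar>real (card (P \<inter> {- int N..int N})) / real (2 * N + 1) - real c / M\<bar> \<le> M / real (2 * N + 1)" for N
    proof -
      have "real (card (P \<inter> {- int N..int N})) / real (2 * N + 1) - real c / M =
        (real (card (P \<inter> {- int N..int N})) - real c / M * real (2 * N + 1)) / real (2 * N + 1)"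
        by (simp add: diff_divide_distrib)
      then show ?thesis using divide_right_mono[OF bound[of N], of "real (2 * N + 1)"] by (simp add: abs_divide)
    qed
    then show "\<forall>\<^sub>F N in sequentially. norm (real (card (P \<inter> {- int N..int N})) / real (2 * N + 1) - real c / M)
      \<le> real M / real (2 * N + 1)" by simp
  qed
  then show ?thesis unfolding c_def by (simp add: LIM_zero_iff)
qed

section \<open>Existence of the density\<close>

definition no_square_upto :: "nat \<Rightarrow> int set" where
  "no_square_upto z = {b. \<forall>k\<in>{2..z}. \<not> square_divides b k}"

definition no_square :: "int set" where
  "no_square = {b. \<forall>k\<ge>2. \<not> square_divides b k}"

lemma squarefree_int_iff:
  fixes n :: int
  shows "squarefree n \<longleftrightarrow> (\<forall>k\<ge>2. \<not> (int k)\<^sup>2 dvd n)"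
proof
  assume n: "squarefree n"
  show "\<forall>k\<ge>2. \<not> (int k)\<^sup>2 dvd n"
  proof (intro allI impI notI)
    fix k :: nat assume "k \<ge> 2" "(int k)\<^sup>2 dvd n"
    from this(2) have "int k dvd 1" by (rule squarefreeD[OF n])
    then show False using \<open>k \<ge> 2\<close> by simp
  qed
next
  assume n: "\<forall>k\<ge>2. \<not> (int k)\<^sup>2 dvd n"
  show "squarefree n"
  proof (rule squarefreeI, rule ccontr)
    fix x :: int assume x: "x\<^sup>2 dvd n" "\<not> x dvd 1"
    show False
    proof (cases "x = 0")
      case True
      then have "n = 0" using x(1) by simp
      then have "(int 2)\<^sup>2 dvd n" by simp
      then show False using n by blast
    next
      case False
      moreover have "\<bar>x\<bar> \<noteq> 1" using x(2) by simp
      ultimately have "nat \<bar>x\<bar> \<ge> 2" by linarith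
      moreover have "(int (nat \<bar>x\<bar>))\<^sup>2 dvd n" using x(1) by simp
      ultimately show False using n by blast
    qed
  qed
qed

lemma no_square_iff: "b \<in> no_square \<longleftrightarrow> squarefree b \<and> squarefree (256 - 27 * b)"
  unfolding no_square_def square_divides_def squarefree_int_iff by blast

lemma no_square_upto_convergent:
  "convergent (\<lambda>N. real (card (no_square_upto z \<inter> {- int N..int N})) / real (2 * N + 1))"
proof -
  define M where "M = (\<Prod>k\<in>{2..z}. k\<^sup>2)"
  have M: "M > 0" unfolding M_def by (intro prod_pos) auto
  have "square_divides (x + int M) k \<longleftrightarrow> square_divides x k" if "k \<in> {2..z}" for x k
  proof -
    have "k\<^sup>2 dvd M" unfolding M_def using that by (intro dvd_prodI) auto
    then have d: "(int k)\<^sup>2 dvd int M" by (metis of_nat_dvd_iff of_nat_power)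
    have e: "256 - 27 * (x + int M) = (256 - 27 * x) + (- 27) * int M" by simp
    show ?thesis
      unfolding square_divides_def e dvd_add_left_iff[OF d] dvd_add_left_iff[OF dvd_mult[OF d]] ..
  qed
  then have "x + int M \<in> no_square_upto z \<longleftrightarrow> x \<in> no_square_upto z" for x
    unfolding no_square_upto_def by blast
  from periodic_density[OF M this] show ?thesis by (rule convergentI)
qed

lemma no_square_upto_diff:
  assumes z: "z \<ge> 2"
  defines "K \<equiv> \<lambda>N. nat \<lfloor>sqrt (256 + 27 * real N)\<rfloor>"
  shows "card (no_square \<inter> {- int N..int N}) \<le> card (no_square_upto z \<inter> {- int N..int N})"
    and "real (card (no_square_upto z \<inter> {- int N..int N})) \<le>
      real (card (no_square \<inter> {- int N..int N})) + (4 * real N / real z + 4 * real (K N))"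
proof -
  show "card (no_square \<inter> {- int N..int N}) \<le> card (no_square_upto z \<inter> {- int N..int N})"
    by (intro card_mono) (auto simp: no_square_def no_square_upto_def)
  let ?B = "{b \<in> {- int N..int N}. \<exists>k\<in>{z<..K N}. square_divides b k}"
  have sub: "no_square_upto z \<inter> {- int N..int N} \<subseteq> (no_square \<inter> {- int N..int N}) \<union> ?B"
  proof
    fix b assume b: "b \<in> no_square_upto z \<inter> {- int N..int N}"
    show "b \<in> (no_square \<inter> {- int N..int N}) \<union> ?B"
    proof (cases "b \<in> no_square")
      case False
      then obtain k where k: "k \<ge> 2" "square_divides b k" by (auto simp: no_square_def)
      have zk: "z < k" using b k by (auto simp: no_square_upto_def not_le[symmetric])
      \<comment> \<open>Since z \<ge> 2 the test at 2 is included; it rules out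
        \<open>b = 0\<close>, for which no bound on \<open>k\<close> would hold.\<close>
      have "\<not> square_divides b 2" using b z by (auto simp: no_square_upto_def)
      then have "b \<noteq> 0" by (auto simp: square_divides_def)
      moreover have "\<bar>b\<bar> \<le> int N" using b by auto
      ultimately have "k \<le> K N" unfolding K_def using k(2) square_divides_bound by blast
      then show ?thesis using b k(2) zk by auto
    qed (use b in blast)
  qed
  have "card (no_square_upto z \<inter> {- int N..int N}) \<le> card ((no_square \<inter> {- int N..int N}) \<union> ?B)"
    by (rule card_mono[OF finite_subset[OF _ finite_atLeastAtMost_int[of "- int N" "int N"]] sub]) blast
  also have "\<dots> \<le> card (no_square \<inter> {- int N..int N}) + card ?B" by (rule card_Un_le)
  finally have 1: "real (card (no_square_upto z \<inter> {- int N..int N})) \<le>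
      real (card (no_square \<inter> {- int N..int N})) + real (card ?B)" by linarith
  have "real (card ?B) \<le> (\<Sum>k\<in>{z<..K N}. 4 * real N / (real k)\<^sup>2 + 4)"
    by (rule card_some_square_divides_le) auto
  also have "\<dots> = 4 * real N * (\<Sum>k\<in>{z<..K N}. 1 / (real k)\<^sup>2) + 4 * real (K N - z)"
    by (simp add: sum.distrib sum_distrib_left)
  also have "\<dots> \<le> 4 * real N * (1 / real z) + 4 * real (K N)"
    using z by (intro add_mono mult_left_mono sum_inverse_squares_tail) auto
  finally show "real (card (no_square_upto z \<inter> {- int N..int N})) \<le>
      real (card (no_square \<inter> {- int N..int N})) + (4 * real N / real z + 4 * real (K N))"
    using 1 by simp
qed

text \<open>For every \<open>z\<close> the frequencies \<open>r\<close> lie within 2 / z +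
  \<epsilon> of a convergent sequence, so \<open>r\<close> is Cauchy.\<close>

lemma no_square_convergent:
  "convergent (\<lambda>N. real (card (no_square \<inter> {- int N..int N})) / real (2 * N + 1))"
proof -
  define r where "r N = real (card (no_square \<inter> {- int N..int N})) / real (2 * N + 1)" for N
  define s where "s z N = real (card (no_square_upto z \<inter> {- int N..int N})) / real (2 * N + 1)" for z N
  define \<epsilon> where "\<epsilon> N = 4 * sqrt (256 + 27 * real N) / real (2 * N + 1)" for N
  have \<epsilon>: "\<epsilon> \<longlonglongrightarrow> 0" unfolding \<epsilon>_def by real_asymp
  have near: "\<bar>s z N - r N\<bar> \<le> 2 / real z + \<epsilon> N" if "z \<ge> 2" for z N
  proof -
    define K where "K = real (nat \<lfloor>sqrt (256 + 27 * real N)\<rfloor>)"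
    have K: "K \<le> sqrt (256 + 27 * real N)" unfolding K_def by simp
    have le: "real (card (no_square \<inter> {- int N..int N})) \<le> real (card (no_square_upto z \<inter> {- int N..int N}))"
      using no_square_upto_diff(1)[OF that] by simp
    have "s z N - r N = (real (card (no_square_upto z \<inter> {- int N..int N})) -
        real (card (no_square \<inter> {- int N..int N}))) / real (2 * N + 1)"
      unfolding s_def r_def by (simp add: diff_divide_distrib)
    moreover have "0 \<le> \<dots>" using le by (intro divide_nonneg_nonneg) auto
    moreover have "(real (card (no_square_upto z \<inter> {- int N..int N})) -
        real (card (no_square \<inter> {- int N..int N}))) / real (2 * N + 1) \<le>
        (4 * real N / real z + 4 * K) / real (2 * N + 1)"
      using no_square_upto_diff(2)[OF that, of N] unfolding K_def by (intro divide_right_mono) linarith+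
    moreover have "\<dots> = 4 * real N / real z / real (2 * N + 1) + 4 * K / real (2 * N + 1)"
      by (rule add_divide_distrib)
    moreover have "4 * K / real (2 * N + 1) \<le> \<epsilon> N"
      unfolding \<epsilon>_def using K by (intro divide_right_mono) auto
    moreover have "4 * real N / real z / real (2 * N + 1) \<le> 2 / real z"
    proof -
      have "4 * real N / real z / real (2 * N + 1) = 2 / real z * (2 * real N / real (2 * N + 1))"
        by simp
      also have "\<dots> \<le> 2 / real z * 1" by (intro mult_left_mono) simp_all
      finally show ?thesis by simp
    qed
    ultimately show ?thesis by linarith
  qed
  have "Cauchy r"
  proof (rule metric_CauchyI)
    fix e :: real assume e: "e > 0"
    \<comment> \<open>Makes 2 / z less than e / 8. Each comparison of \<open>r\<close> with
      \<open>s z\<close> then costs under e / 4, for a total under 3 e / 4.\<close>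
    obtain z0 :: nat where z0: "16 / e < real z0" using reals_Archimedean2 by blast
    define z where "z = max 2 z0"
    have z: "z \<ge> 2" "2 / real z < e / 8"
    proof -
      have "16 / e < real z" using z0 by (simp add: z_def)
      then show "2 / real z < e / 8" using e by (simp add: z_def field_simps)
    qed (simp add: z_def)
    have "Cauchy (s z)" unfolding s_def using no_square_upto_convergent[of z] by (rule convergent_Cauchy)
    then obtain N1 where N1: "\<And>m n. m \<ge> N1 \<Longrightarrow> n \<ge> N1 \<Longrightarrow> dist (s z m) (s z n) < e / 4"
      using metric_CauchyD[of "s z" "e / 4"] e by auto
    obtain N2 where N2: "\<And>n. n \<ge> N2 \<Longrightarrow> \<bar>\<epsilon> n\<bar> < e / 8"
      using LIMSEQ_D[OF \<epsilon>, of "e / 8"] e by auto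
    show "\<exists>M. \<forall>m\<ge>M. \<forall>n\<ge>M. dist (r m) (r n) < e"
    proof (intro exI[of _ "max N1 N2"] allI impI)
      fix m n assume mn: "m \<ge> max N1 N2" "n \<ge> max N1 N2"
      have "\<bar>s z m - s z n\<bar> < e / 4" using N1[of m n] mn by (simp add: dist_real_def)
      moreover have "\<bar>\<epsilon> m\<bar> < e / 8" "\<bar>\<epsilon> n\<bar> < e / 8" using N2 mn by auto
      ultimately have "\<bar>r m - r n\<bar> < e" using near[OF z(1), of m] near[OF z(1), of n] z(2) e by linarith
      then show "dist (r m) (r n) < e" by (simp add: dist_real_def)
    qed
  qed
  then show ?thesis unfolding r_def by (rule real_Cauchy_convergent)
qed

section \<open>Lower bound for the density\<close>

text \<open>A prime factor of \<open>k\<close> already violates the condition. Primes from 5 on are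
  relaxed to odd numbers, whose inverse squares are easily summed.\<close>

lemma not_no_square_cases:
  assumes b: "b \<notin> no_square" "\<bar>b\<bar> \<le> int N"
  shows "int 4 dvd b \<or> int 9 dvd b \<or>
    (\<exists>j\<in>{2..nat \<lfloor>sqrt (256 + 27 * real N)\<rfloor>}. square_divides b (2 * j + 1))"
proof (cases "b = 0")
  case False
  obtain k where k: "k \<ge> 2" "square_divides b k" using b by (auto simp: no_square_def)
  obtain p where p: "Factorial_Ring.prime p" "p dvd k" using k(1) prime_factor_nat[of k] by auto
  have "(int p)\<^sup>2 dvd (int k)\<^sup>2" using p(2) by (intro dvd_power_same) simp
  then have sp: "square_divides b p"
    using k(2) dvd_trans unfolding square_divides_def by blast
  have "p \<ge> 2" using p(1) by (rule prime_ge_2_nat)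
  consider "p = 2" | "p = 3" | "p \<ge> 4" using \<open>p \<ge> 2\<close> by linarith
  then show ?thesis
  proof cases
    case 1
    then have "4 dvd b \<or> 4 dvd 256 - 27 * b" using sp by (simp add: square_divides_def)
    then have "4 dvd b" by presburger
    then show ?thesis by simp
  next
    case 2
    then have "9 dvd b \<or> 9 dvd 256 - 27 * b" using sp by (simp add: square_divides_def)
    then have "9 dvd b" by presburger
    then show ?thesis by simp
  next
    case 3
    then have "odd p" using p(1) prime_odd_nat[of p] by simp
    then obtain j where j: "p = 2 * j + 1" by (auto elim: oddE)
    have "p \<le> nat \<lfloor>sqrt (256 + 27 * real N)\<rfloor>" by (rule square_divides_bound[OF sp False b(2)])
    then have "j \<in> {2..nat \<lfloor>sqrt (256 + 27 * real N)\<rfloor>}" using 3 j by auto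
    then show ?thesis using sp unfolding j by blast
  qed
qed simp

text \<open>11/9 = 2/4 + 2/9 + 4/8, from multiples of 4, multiples of 9 and the odd squares from 25
  on.\<close>

lemma no_square_lower_bound:
  "real (card (no_square \<inter> {- int N..int N})) \<ge> 2 * real N + 1 -
     (11 / 9 * real N + 4 + 4 * sqrt (256 + 27 * real N))"
proof -
  define K where "K = nat \<lfloor>sqrt (256 + 27 * real N)\<rfloor>"
  define I where "I = {- int N..int N}"
  define D where "D = (\<lambda>j. 2 * j + 1) ` {2..K}"
  let ?A = "{b \<in> I. int 4 dvd b}" and ?B = "{b \<in> I. int 9 dvd b}"
    and ?C = "{b \<in> I. \<exists>k\<in>D. square_divides b k}"
  have finI: "finite I" by (simp add: I_def)
  have "I \<subseteq> (no_square \<inter> I) \<union> (?A \<union> (?B \<union> ?C))"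
  proof
    fix b assume b: "b \<in> I"
    then have "\<bar>b\<bar> \<le> int N" by (auto simp: I_def)
    then show "b \<in> (no_square \<inter> I) \<union> (?A \<union> (?B \<union> ?C))"
      using not_no_square_cases[of b N] b unfolding D_def K_def by blast
  qed
  then have "card I \<le> card ((no_square \<inter> I) \<union> (?A \<union> (?B \<union> ?C)))"
    using finI by (intro card_mono) auto
  also have "\<dots> \<le> card (no_square \<inter> I) + (card ?A + (card ?B + card ?C))"
    by (meson add_left_mono card_Un_le order_trans)
  finally have 1: "real (card I) \<le> real (card (no_square \<inter> I)) + (real (card ?A) + (real (card ?B) + real (card ?C)))"
    by linarith
  have A: "real (card ?A) \<le> 2 * real N / 4 + 2" "real (card ?B) \<le> 2 * real N / 9 + 2"
    unfolding I_def using card_dvd_le[of 4 N] card_dvd_le[of 9 N] by simp_all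
  have "real (card ?C) \<le> (\<Sum>k\<in>D. 4 * real N / (real k)\<^sup>2 + 4)"
    unfolding I_def by (rule card_some_square_divides_le) (auto simp: D_def)
  also have "\<dots> = (\<Sum>j\<in>{2..K}. 4 * real N / (real (2 * j + 1))\<^sup>2 + 4)"
    unfolding D_def by (subst sum.reindex) (auto simp: inj_on_def)
  also have "\<dots> = 4 * real N * (\<Sum>j\<in>{2..K}. 1 / (real (2 * j + 1))\<^sup>2) + 4 * real (card {2..K})"
    by (simp add: sum.distrib sum_distrib_left)
  also have "\<dots> \<le> 4 * real N * (1 / 8) + 4 * real K"
    by (intro add_mono mult_left_mono sum_inverse_odd_squares) auto
  finally have C: "real (card ?C) \<le> real N / 2 + 4 * real K" by simp
  have "real K \<le> sqrt (256 + 27 * real N)" unfolding K_def by simp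
  moreover have "real (card I) = 2 * real N + 1" by (simp add: I_def)
  ultimately show ?thesis using 1 A C unfolding I_def[symmetric] by linarith
qed

lemma natural_density_monogeneity:
  obtains \<delta> where "has_natural_density {b. monogeneity_hypotheses b b} \<delta>" "\<delta> \<ge> 7 / 18"
proof -
  obtain \<delta> where \<delta>: "(\<lambda>N. real (card (no_square \<inter> {- int N..int N})) / real (2 * N + 1)) \<longlonglongrightarrow> \<delta>"
    using no_square_convergent by (auto simp: convergent_def)
  have "{b \<in> {b. monogeneity_hypotheses b b}. \<bar>b\<bar> \<le> int N} = no_square \<inter> {- int N..int N}" for N
    by (auto simp: monogeneity_hypotheses_iff no_square_iff)
  moreover have "{b. \<bar>b\<bar> \<le> int N} = {- int N..int N}" for N by auto
  moreover have "real (card {- int N..int N}) = real (2 * N + 1)" for N by simp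
  ultimately have "has_natural_density {b. monogeneity_hypotheses b b} \<delta>"
    unfolding has_natural_density_def using \<delta> by (simp only:)
  \<comment> \<open>7/18 is half of 2 - 11/9.\<close>
  moreover have "7 / 18 \<le> \<delta>"
  proof (rule LIMSEQ_le[OF _ \<delta>])
    show "(\<lambda>N. (2 * real N + 1 - (11 / 9 * real N + 4 + 4 * sqrt (256 + 27 * real N))) / real (2 * N + 1))
        \<longlonglongrightarrow> 7 / 18" by real_asymp
    show "\<exists>n0. \<forall>N\<ge>n0. (2 * real N + 1 - (11 / 9 * real N + 4 + 4 * sqrt (256 + 27 * real N))) / real (2 * N + 1)
        \<le> real (card (no_square \<inter> {- int N..int N})) / real (2 * N + 1)"
      using no_square_lower_bound by (intro exI allI impI divide_right_mono) auto
  qed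
  ultimately show ?thesis by (rule that)
qed

text \<open>The value is about 0.291845, near the end 0.29185 of the rounding interval, hence the
  sharp lower bound for pi.\<close>

lemma density_bound_numeric:
  "\<bar>(51 - 4 * pi\<^sup>2) / (4 * pi\<^sup>2) - 29.18 / 100\<bar> < 0.005 / 100"
proof -
  have "3.14159\<^sup>2 \<le> pi\<^sup>2" "pi\<^sup>2 \<le> 3.1416\<^sup>2"
    using pi_approx by (intro power_mono; simp)+
  then have P: "9.869587 \<le> pi\<^sup>2" "pi\<^sup>2 \<le> 9.8697" by (simp_all add: power2_eq_square)
  then show ?thesis using P by (auto simp: abs_if field_simps)
qed

section \<open>Assembling Galois group and density\<close>

theorem theorem3p3:
  shows
    "(\<forall>(b :: int) (\<theta> :: complex).
        squarefree b \<and> squarefree (256 - 27 * b) \<and>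
        poly (map_poly of_int (quartic b b)) \<theta> = 0 \<longrightarrow>
          monogeneity_hypotheses b b \<and>
          (b \<noteq> 3 \<and> b \<noteq> 5 \<longrightarrow>
             number_field_galois_group (rat_adjoin \<theta>) \<cong> sym_group 4)) \<and>
     (\<exists>\<delta> :: real.
        has_natural_density {b :: int. monogeneity_hypotheses b b} \<delta> \<and>
        \<delta> \<ge> (51 - 4 * pi\<^sup>2) / (4 * pi\<^sup>2)) \<and>
     \<bar>(51 - 4 * pi\<^sup>2) / (4 * pi\<^sup>2) - 29.18 / 100\<bar> < 0.005 / 100"
proof (intro conjI)
  show "\<forall>(b :: int) (\<theta> :: complex).
      squarefree b \<and> squarefree (256 - 27 * b) \<and>
      poly (map_poly of_int (quartic b b)) \<theta> = 0 \<longrightarrow>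
        monogeneity_hypotheses b b \<and>
        (b \<noteq> 3 \<and> b \<noteq> 5 \<longrightarrow> number_field_galois_group (rat_adjoin \<theta>) \<cong> sym_group 4)"
    using monogeneity_hypotheses_iff number_field_galois_group_quartic by blast
  obtain \<delta> where \<delta>: "has_natural_density {b. monogeneity_hypotheses b b} \<delta>" "\<delta> \<ge> 7 / 18"
    by (rule natural_density_monogeneity)
  \<comment> \<open>The rounded value alone already places the claimed constant below 7/18.\<close>
  have "x \<le> \<delta>" if "\<bar>x - 29.18 / 100\<bar> < 0.005 / 100" for x :: real
  proof -
    have "x - 29.18 / 100 < 0.005 / 100" using that unfolding abs_less_iff by (rule conjunct1)
    then have "x < 7 / 18" by simp
    then show ?thesis using \<delta>(2) by linarith
  qed
  note this[OF density_bound_numeric]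
  with \<delta>(1) show "\<exists>\<delta> :: real. has_natural_density {b :: int. monogeneity_hypotheses b b} \<delta> \<and>
      \<delta> \<ge> (51 - 4 * pi\<^sup>2) / (4 * pi\<^sup>2)" by blast
qed (rule density_bound_numeric)

end
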